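(* Let $f:[1,\infty)\to\mathbb{R}$ be non-negative and non-decreasing, and assume that $F(x)=\sum_{n\le x} f(x/n)$ (sum over positive integers $n\le x$) satisfies \[ F(x)=Ax\log x+Bx+C\frac{x}{\log x}+o\!\left(\frac{x}{\log x}\right)\quad (x\to\infty) \] for some real constants $A,B,C$. Put $g(x)=f(x)-Ax$. Then there is a function $h$ with $h(x)\to0$ as $x\to\infty$ such that for all $x>1$ \[ \frac{|g(x)|}{x}\le \frac{1}{\log x}\int_1^x\frac{|g(t)|}{t^2}\,dt+h(x). \] *)

theory Defs
  imports "HOL-Analysis.Analysis" "HOL-Library.Landau_Symbols"
begin

definition dilate_sum :: "(real \<Rightarrow> real) \<Rightarrow> real \<Rightarrow> real" where
  "dilate_sum f x = (\<Sum>n | 1 \<le> n \<and> real n \<le> x. f (x / real n))"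

end

theory Submission
  imports Defs "HOL-Number_Theory.Prime_Powers" "HOL-Computational_Algebra.Squarefree"
begin

text \<open>
  The argument is Selberg's. The Tatuzawa--Iseki identity turns the asymptotics of
  \<open>\<Sum>\<^sub>n g(x/n)\<close> into \<open>g(x) ln x + \<Sum>\<^sub>n \<Lambda>(n) g(x/n) = o(x ln x)\<close>. For \<open>f = \<psi>\<close> this is Selberg's formula
  with error \<open>o(x ln x)\<close>, so that \<open>v = \<Lambda> + (\<Lambda> * \<Lambda>) / ln\<close> has summatory function \<open>2 x + o(x)\<close>. As \<open>f\<close> is
  monotone, summation by parts allows \<open>v\<close> to be replaced by its mean \<open>2\<close> in sums of \<open>g(x/n)\<close> and
  of \<open>|g(x/n)|\<close>. Since \<open>\<Sum>\<^sub>n g(x/n) = O(x)\<close>, the former shows that \<open>g(x) ln x\<close> equals both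
  \<open>- \<Sum>\<^sub>n \<Lambda>(n) g(x/n)\<close> and \<open>\<Sum>\<^sub>n (\<Lambda> * \<Lambda>)(n) / ln n \<cdot> g(x/n)\<close> up to \<open>o(x ln x)\<close>. Adding absolute values
  gives \<open>2 |g(x)| ln x \<le> \<Sum>\<^sub>n v(n) |g(x/n)| + o(x ln x)\<close>, whose right-hand side is
  \<open>2 \<Sum>\<^sub>n |g(x/n)| + o(x ln x)\<close>, and this sum is compared with the integral.
\<close>

subsection \<open>The Moebius function and sums over dilates\<close>

definition pnats :: "real \<Rightarrow> nat set" where
  "pnats x = {n. 1 \<le> n \<and> real n \<le> x}"

lemma pnats_eq: "pnats x = {1..nat \<lfloor>x\<rfloor>}"
proof -
  have "real n \<le> x \<longleftrightarrow> n \<le> nat \<lfloor>x\<rfloor>" if "1 \<le> n" for n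
    using that by linarith
  then show ?thesis unfolding pnats_def by auto
qed

lemma finite_pnats [simp, intro]: "finite (pnats x)"
  by (simp add: pnats_eq)

lemma dilate_sum_pnats: "dilate_sum f x = (\<Sum>n\<in>pnats x. f (x / real n))"
  by (simp add: dilate_sum_def pnats_def)

lemma pnatsD:
  assumes "n \<in> pnats x"
  shows "1 \<le> n" "0 < n" "1 \<le> real n" "0 < real n" "real n \<le> x" "1 \<le> x" "1 \<le> x / real n" "x / real n \<le> x"
proof -
  show *: "1 \<le> n" "real n \<le> x" "0 < n" "1 \<le> real n" "0 < real n" using assms by (auto simp: pnats_def)
  show "1 \<le> x" using * by linarith
  show "1 \<le> x / real n" "x / real n \<le> x" using * by (auto simp: field_simps mult_left_le)
qed

lemma one_in_pnats: "x \<ge> 1 \<Longrightarrow> 1 \<in> pnats x"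
  by (simp add: pnats_def)

lemma card_pnats_le: "x \<ge> 0 \<Longrightarrow> real (card (pnats x)) \<le> x"
  by (simp add: pnats_eq)

lemma card_pnats_ge: "x \<ge> 0 \<Longrightarrow> x - 1 \<le> real (card (pnats x))"
  by (simp add: pnats_eq)

text \<open>The operators taking \<open>g\<close> to the sum of \<open>a n * g (x / n)\<close>
  compose by Dirichlet convolution of their weights: the pair \<open>(m, n)\<close> is recorded as
  its product \<open>k = m * n\<close> together with the divisor \<open>d = m\<close>.\<close>

lemma dilate_convolve:
  fixes a b :: "nat \<Rightarrow> real"
  shows "(\<Sum>m\<in>pnats x. a m * (\<Sum>n\<in>pnats (x / real m). b n * g (x / real m / real n))) =
         (\<Sum>k\<in>pnats x. (\<Sum>d | d dvd k. a d * b (k div d)) * g (x / real k))"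
proof -
  have "(\<Sum>m\<in>pnats x. a m * (\<Sum>n\<in>pnats (x / real m). b n * g (x / real m / real n))) =
        (\<Sum>(m,n)\<in>(SIGMA m:pnats x. pnats (x / real m)). a m * b n * g (x / real m / real n))"
    by (subst sum.Sigma [symmetric]) (auto simp: sum_distrib_left mult.assoc)
  also have "\<dots> = (\<Sum>(k,d)\<in>(SIGMA k:pnats x. {d. d dvd k}). a d * b (k div d) * g (x / real k))"
  proof (rule sum.reindex_bij_witness[where j="\<lambda>(m,n). (m*n, m)" and i="\<lambda>(k,d). (d, k div d)"], goal_cases)
    case (1 a) then show ?case by (auto dest: pnatsD)
  next
    case (2 a)
    then obtain m n where a: "a = (m, n)" "m \<in> pnats x" "n \<in> pnats (x / real m)" by auto
    then have "real m * real n \<le> x"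
      using pnatsD[OF a(2)] pnatsD[OF a(3)] by (auto simp: field_simps)
    then show ?case using a pnatsD[OF a(2)] pnatsD[OF a(3)] by (auto simp: pnats_def)
  next
    case (3 b) then show ?case by auto
  next
    case (4 b)
    then obtain k d where b: "b = (k, d)" "k \<in> pnats x" "d dvd k" by auto
    then obtain e where e: "k = d * e" by auto
    have pos: "d \<ge> 1" "e \<ge> 1" using pnatsD[OF b(2)] e by (auto simp: Suc_le_eq)
    have "real d * real e \<le> x" using pnatsD(5)[OF b(2)] e by simp
    moreover have "real d * 1 \<le> real d * real e" using pos by (intro mult_left_mono) auto
    ultimately have "real d \<le> x" "real e \<le> x / real d"
      using pos by (linarith, simp add: field_simps)
    then show ?case using b e pos by (auto simp: pnats_def)
  next
    case (5 a) then show ?case by (auto dest: pnatsD)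
  qed
  also have "\<dots> = (\<Sum>k\<in>pnats x. (\<Sum>d | d dvd k. a d * b (k div d)) * g (x / real k))"
    by (subst sum.Sigma [symmetric]) (auto simp: sum_distrib_right dest: pnatsD)
  finally show ?thesis .
qed

definition moebius_mu :: "nat \<Rightarrow> real" where
  "moebius_mu n = (if squarefree n then (-1) ^ card (prime_factors n) else 0)"

lemma abs_moebius_mu_le: "\<bar>moebius_mu n\<bar> \<le> 1"
  by (auto simp: moebius_mu_def)

lemma moebius_mu_1 [simp]: "moebius_mu (Suc 0) = 1"
  using squarefree_1[where 'a=nat] by (simp add: moebius_mu_def)

lemma moebius_mu_prime_times:
  assumes "prime p" "\<not> p dvd d"
  shows "moebius_mu (p * d) = - moebius_mu d"
proof -
  have d: "d \<noteq> 0" using assms by (intro notI) auto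
  have p0: "p \<noteq> 0" using assms by auto
  have cop: "coprime p d" using assms by (simp add: prime_imp_coprime)
  have "squarefree (p * d) \<longleftrightarrow> squarefree d"
    using squarefree_mult_coprime[OF cop] squarefree_prime[OF assms(1)] squarefree_multD by blast
  moreover have "prime_factors (p * d) = insert p (prime_factors d)"
    using assms d p0 by (simp add: prime_factors_product prime_prime_factors)
  moreover have "p \<notin> prime_factors d" using assms by auto
  ultimately show ?thesis by (simp add: moebius_mu_def)
qed

text \<open>Fix a prime \<open>p\<close> dividing \<open>n > 1\<close>. Divisors divisible by the
  square of \<open>p\<close> contribute nothing, and the others cancel in pairs \<open>d\<close>,
  \<open>p * d\<close>.\<close>

lemma sum_moebius_mu_dvd:
  assumes "n > 0"
  shows "(\<Sum>d | d dvd n. moebius_mu d) = (if n = 1 then 1 else 0)"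
proof (cases "n = 1")
  case False
  then obtain p where p: "prime p" "p dvd n" using prime_factor_nat by blast
  let ?A = "{d. d dvd n \<and> \<not> p dvd d}" and ?B = "{d. d dvd n \<and> p dvd d \<and> \<not> p\<^sup>2 dvd d}"
  have fin: "finite {d. d dvd n}" using assms by (rule finite_divisors_nat)
  have "(\<Sum>d | d dvd n. moebius_mu d) = (\<Sum>d\<in>?A \<union> ?B. moebius_mu d)"
  proof (rule sum.mono_neutral_right[OF fin])
    show "\<forall>i\<in>{d. d dvd n} - (?A \<union> ?B). moebius_mu i = 0"
    proof
      fix i assume "i \<in> {d. d dvd n} - (?A \<union> ?B)"
      then have "p\<^sup>2 dvd i" by blast
      then have "\<not> squarefree i"
        using p(1) not_prime_unit by (intro not_squarefreeI[of p]) auto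
      then show "moebius_mu i = 0" by (simp add: moebius_mu_def)
    qed
  qed auto
  also have "\<dots> = sum moebius_mu ?A + sum moebius_mu ?B"
    by (rule sum.union_disjoint) (auto intro: finite_subset[OF _ fin])
  also have "sum moebius_mu ?B = (\<Sum>d\<in>?A. moebius_mu (p * d))"
  proof (rule sum.reindex_bij_witness[where i="\<lambda>d. p * d" and j="\<lambda>d. d div p"], goal_cases)
    case (1 a) then show ?case by auto
  next
    case (2 a)
    then obtain e where e: "a = p * e" by auto
    with 2 p have "\<not> p dvd e" by (auto simp: power2_eq_square)
    moreover have "e dvd n" using 2 e by (auto intro: dvd_mult_right)
    ultimately show ?case using e p by (auto simp: prime_gt_0_nat)
  next
    case (3 b) then show ?case using p by (auto simp: prime_gt_0_nat)
  next
    case (4 b)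
    then have "coprime p b" using p by (simp add: prime_imp_coprime)
    then have "p * b dvd n" using 4 p by (simp add: divides_mult)
    then show ?case using 4 p by (auto simp: power2_eq_square prime_gt_0_nat)
  next
    case (5 a) then show ?case by auto
  qed
  also have "\<dots> = (\<Sum>d\<in>?A. - moebius_mu d)"
    by (rule sum.cong) (auto simp: moebius_mu_prime_times p)
  finally show ?thesis using False by (simp add: sum_negf)
qed auto

text \<open>Both pairs of conditions say that \<open>d * e\<close> divides \<open>n\<close>. This
  symmetry permits the exchange of summation in double divisor sums.\<close>

lemma dvd_div_swap:
  assumes "d dvd n" "e dvd n div d" "n > (0::nat)"
  shows "e dvd n" "d dvd n div e"
proof -
  obtain l where l: "n = d * l" using assms(1) by (rule dvdE)
  with assms(3) have "n div d = l" by simp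
  with assms(2) obtain k where "l = e * k" by (metis dvdE)
  with l have k: "n = e * (d * k)" by simp
  then have "n div e = d * k" using assms(3) by (metis nonzero_mult_div_cancel_left mult_0 less_irrefl)
  then show "e dvd n" "d dvd n div e" using k by auto
qed

text \<open>Moebius inversion of the divisor sum of \<open>mangoldt\<close>, which is
  \<open>ln\<close>, gives \<open>mangoldt n\<close> as the sum of
  \<open>moebius_mu d * ln (n / d)\<close>. Splitting \<open>ln (n / d)\<close> leaves a term with
  \<open>ln n\<close>, which vanishes: for \<open>n > 1\<close> because the sum of
  \<open>moebius_mu d\<close> is 0, for \<open>n = 1\<close> because
  \<open>ln 1 = 0\<close>.\<close>

lemma sum_moebius_mu_ln_dvd:
  assumes "n > 0"
  shows "(\<Sum>d | d dvd n. moebius_mu d * ln (real d)) = - mangoldt n"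
proof -
  have "(\<Sum>d | d dvd n. moebius_mu d * ln (real (n div d))) =
        (\<Sum>d | d dvd n. \<Sum>e | e dvd n div d. moebius_mu d * mangoldt e)"
  proof (rule sum.cong[OF refl])
    fix d assume "d \<in> {d. d dvd n}"
    then have "n div d \<noteq> 0" using assms by auto
    from mangoldt_sum[OF this, where 'a=real]
    show "moebius_mu d * ln (real (n div d)) = (\<Sum>e | e dvd n div d. moebius_mu d * mangoldt e)"
      by (simp add: sum_distrib_left [symmetric])
  qed
  also have "\<dots> = (\<Sum>(d,e)\<in>(SIGMA d:{d. d dvd n}. {e. e dvd n div d}). moebius_mu d * mangoldt e)"
    by (rule sum.Sigma) (use assms in auto)
  also have "\<dots> = (\<Sum>(e,d)\<in>(SIGMA e:{e. e dvd n}. {d. d dvd n div e}). moebius_mu d * mangoldt e)"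
  proof (rule sum.reindex_bij_witness[where i="\<lambda>(e,d). (d,e)" and j="\<lambda>(d,e). (e,d)"], goal_cases)
    case (2 a)
    then obtain d e where de: "a = (d, e)" "d dvd n" "e dvd n div d" by auto
    then have "e dvd n" "d dvd n div e" using dvd_div_swap assms by blast+
    then show ?case using de by auto
  next
    case (4 b)
    then obtain d e where de: "b = (d, e)" "d dvd n" "e dvd n div d" by auto
    then have "e dvd n" "d dvd n div e" using dvd_div_swap assms by blast+
    then show ?case using de by auto
  qed auto
  also have "\<dots> = (\<Sum>e | e dvd n. \<Sum>d | d dvd n div e. moebius_mu d * mangoldt e)"
    by (rule sum.Sigma[symmetric]) (use assms in auto)
  also have "\<dots> = (\<Sum>e | e dvd n. if e = n then mangoldt e else 0)"
  proof (rule sum.cong[OF refl])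
    fix e assume e: "e \<in> {e. e dvd n}"
    then have "n div e > 0" using assms by (auto simp: dvd_div_eq_0_iff)
    moreover have "n div e = 1 \<longleftrightarrow> e = n" using e assms
      by (metis div_self mem_Collect_eq mult.right_neutral dvd_mult_div_cancel neq0_conv)
    ultimately show "(\<Sum>d | d dvd n div e. moebius_mu d * mangoldt e) = (if e = n then mangoldt e else 0)"
      by (simp add: sum_distrib_right [symmetric] sum_moebius_mu_dvd)
  qed
  also have "\<dots> = mangoldt n" using assms by (subst sum.delta) auto
  finally have 1: "(\<Sum>d | d dvd n. moebius_mu d * ln (real (n div d))) = mangoldt n" .
  have "(\<Sum>d | d dvd n. moebius_mu d * ln (real (n div d))) =
        (\<Sum>d | d dvd n. moebius_mu d * ln (real n) - moebius_mu d * ln (real d))"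
  proof (rule sum.cong[OF refl])
    fix d assume "d \<in> {d. d dvd n}"
    then have "real (n div d) = real n / real d" "d > 0" using assms by (auto simp: real_of_nat_div intro!: Nat.gr0I)
    then show "moebius_mu d * ln (real (n div d)) = moebius_mu d * ln (real n) - moebius_mu d * ln (real d)"
      using assms by (simp add: ln_div right_diff_distrib)
  qed
  also have "\<dots> = (\<Sum>d | d dvd n. moebius_mu d) * ln (real n) - (\<Sum>d | d dvd n. moebius_mu d * ln (real d))"
    by (simp add: sum_subtractf sum_distrib_right)
  finally show ?thesis using 1 sum_moebius_mu_dvd[OF assms] by auto
qed

text \<open>After convolution the coefficient of \<open>g (x / k)\<close> is the divisor sum of
  \<open>moebius_mu d * (ln x - ln d)\<close>. Its first part survives only for
  \<open>k = 1\<close>, its second part is \<open>mangoldt k\<close>.\<close>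

lemma tatuzawa_iseki:
  fixes g :: "real \<Rightarrow> real"
  assumes "x \<ge> 1"
  shows "(\<Sum>n\<in>pnats x. moebius_mu n * ln (x / real n) * dilate_sum g (x / real n)) =
         g x * ln x + (\<Sum>n\<in>pnats x. mangoldt n * g (x / real n))"
proof -
  have "(\<Sum>n\<in>pnats x. moebius_mu n * ln (x / real n) * dilate_sum g (x / real n)) =
        (\<Sum>k\<in>pnats x. (\<Sum>d | d dvd k. moebius_mu d * ln (x / real d) * 1) * g (x / real k))"
    unfolding dilate_convolve[where a="\<lambda>n. moebius_mu n * ln (x / real n)" and b="\<lambda>_. 1", symmetric]
    by (simp add: dilate_sum_pnats)
  also have "\<dots> = (\<Sum>k\<in>pnats x. (if k = 1 then g x * ln x else 0) + mangoldt k * g (x / real k))"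
  proof (rule sum.cong[OF refl])
    fix k assume k: "k \<in> pnats x"
    have "(\<Sum>d | d dvd k. moebius_mu d * ln (x / real d) * 1) =
          (\<Sum>d | d dvd k. moebius_mu d * ln x - moebius_mu d * ln (real d))"
    proof (rule sum.cong[OF refl])
      fix d assume "d \<in> {d. d dvd k}"
      then have "d > 0" using pnatsD[OF k] by (auto intro!: Nat.gr0I)
      then show "moebius_mu d * ln (x / real d) * 1 = moebius_mu d * ln x - moebius_mu d * ln (real d)"
        using assms by (simp add: ln_div right_diff_distrib)
    qed
    also have "\<dots> = (\<Sum>d | d dvd k. moebius_mu d) * ln x + mangoldt k"
      using sum_moebius_mu_ln_dvd[of k] pnatsD[OF k] by (simp add: sum_subtractf sum_distrib_right)
    finally show "(\<Sum>d | d dvd k. moebius_mu d * ln (x / real d) * 1) * g (x / real k) =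
       (if k = 1 then g x * ln x else 0) + mangoldt k * g (x / real k)"
      using pnatsD[OF k] by (simp add: sum_moebius_mu_dvd algebra_simps)
  qed
  also have "\<dots> = g x * ln x + (\<Sum>n\<in>pnats x. mangoldt n * g (x / real n))"
    using one_in_pnats[OF assms] by (simp add: sum.distrib sum.delta)
  finally show ?thesis .
qed

lemma moebius_inversion_dilate:
  fixes g :: "real \<Rightarrow> real"
  assumes "x \<ge> 1"
  shows "(\<Sum>n\<in>pnats x. moebius_mu n * dilate_sum g (x / real n)) = g x"
proof -
  have "(\<Sum>n\<in>pnats x. moebius_mu n * dilate_sum g (x / real n)) =
        (\<Sum>k\<in>pnats x. (\<Sum>d | d dvd k. moebius_mu d * 1) * g (x / real k))"
    unfolding dilate_convolve[where a=moebius_mu and b="\<lambda>_. 1", symmetric] by (simp add: dilate_sum_pnats)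
  also have "\<dots> = (\<Sum>k\<in>pnats x. if k = 1 then g x else 0)"
    by (rule sum.cong) (auto simp: sum_moebius_mu_dvd dest: pnatsD)
  also have "\<dots> = g x" using one_in_pnats[OF assms] by (simp add: sum.delta)
  finally show ?thesis .
qed

text \<open>Moebius inversion is applied to the constant function 1, whose dilate sum is the integer
  part. Replacing the integer part of \<open>x / n\<close> by \<open>x / n\<close> costs at most 1
  per term, hence at most \<open>x\<close> in all.\<close>

lemma sum_moebius_mu_over_n_bounded:
  assumes "x \<ge> 1"
  shows "\<bar>\<Sum>n\<in>pnats x. moebius_mu n / real n\<bar> \<le> 2"
proof -
  have "x * (\<Sum>n\<in>pnats x. moebius_mu n / real n) - 1 =
     (\<Sum>n\<in>pnats x. moebius_mu n * (x / real n - dilate_sum (\<lambda>_. 1) (x / real n)))"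
    using moebius_inversion_dilate[OF assms, of "\<lambda>_. 1"]
    by (simp add: right_diff_distrib sum_subtractf sum_distrib_left mult_ac)
  also have "\<bar>\<dots>\<bar> \<le> (\<Sum>n\<in>pnats x. 1)"
  proof (rule order_trans[OF sum_abs], rule sum_mono)
    fix n assume "n \<in> pnats x"
    from pnatsD[OF this] have "\<bar>x / real n - dilate_sum (\<lambda>_. 1) (x / real n)\<bar> \<le> 1"
      using card_pnats_le[of "x / real n"] card_pnats_ge[of "x / real n"]
      by (simp add: dilate_sum_pnats abs_le_iff)
    with abs_moebius_mu_le[of n]
    show "\<bar>moebius_mu n * (x / real n - dilate_sum (\<lambda>_. 1) (x / real n))\<bar> \<le> 1"
      by (simp add: abs_mult mult_le_one)
  qed
  also have "\<dots> \<le> x" using card_pnats_le[of x] assms by simp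
  finally have "\<bar>x * (\<Sum>n\<in>pnats x. moebius_mu n / real n)\<bar> \<le> x * 2" using assms by linarith
  then show ?thesis using assms by (simp add: abs_mult)
qed

lemma harmonic_sum_asymp:
  assumes "y \<ge> 1"
  shows "\<bar>(\<Sum>n\<in>pnats y. 1 / real n) - ln y - euler_mascheroni\<bar> \<le> 2 / y"
proof -
  define N where "N = nat \<lfloor>y\<rfloor>"
  have N: "real N \<le> y" "y \<le> real N + 1" "N \<ge> 1" using assms unfolding N_def by linarith+
  have H: "(\<Sum>n\<in>pnats y. 1 / real n) = harm N"
    by (simp add: pnats_eq harm_def N_def inverse_eq_divide)
  have "0 \<le> inverse (real (2*(N+1)))" by simp
  moreover have "inverse (real (2*N)) \<le> 1 / y" using N assms by (simp add: field_simps)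
  \<comment> \<open>The known bounds for the Euler-Mascheroni constant are stated with
    \<open>ln (N + 1)\<close>; passing from there to \<open>ln y\<close> costs another
    \<open>1 / y\<close>.\<close>
  ultimately have 1: "\<bar>harm N - ln (real (Suc N)) - euler_mascheroni\<bar> \<le> 1 / y"
    using euler_mascheroni_bounds[OF N(3)] unfolding atLeastAtMost_iff by linarith
  have "ln (real (Suc N)) - ln y = ln (real (Suc N) / y)" using N assms by (simp add: ln_div)
  also have "\<dots> \<le> real (Suc N) / y - 1" using N assms by (intro ln_le_minus_one) auto
  also have "\<dots> \<le> 1 / y" using N assms by (simp add: field_simps)
  finally have "ln (real (Suc N)) - ln y \<le> 1 / y" .
  moreover have "ln (real (Suc N)) - ln y \<ge> 0" using N assms by simp
  moreover have "2 / y = 1 / y + 1 / y" by simp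
  ultimately show ?thesis using 1 unfolding H by linarith
qed

text \<open>Moebius inversion is now applied to the identity function, whose dilate sum is
  \<open>y * ln y + euler_mascheroni * y\<close> up to a bounded error. These errors add up to at
  most \<open>2 * x\<close>, and the linear term is controlled by the previous bound on the sum of
  \<open>moebius_mu n / n\<close>.\<close>

lemma sum_moebius_mu_ln_over_n_bounded:
  obtains K where "\<And>x. x \<ge> 1 \<Longrightarrow> \<bar>\<Sum>n\<in>pnats x. moebius_mu n / real n * ln (x / real n)\<bar> \<le> K"
proof
  fix x :: real assume x: "x \<ge> 1"
  define M0 M1 where "M0 = (\<Sum>n\<in>pnats x. moebius_mu n / real n)"
    and "M1 = (\<Sum>n\<in>pnats x. moebius_mu n / real n * ln (x / real n))"
  have "x - x * M1 - euler_mascheroni * x * M0 =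
     (\<Sum>n\<in>pnats x. moebius_mu n * (dilate_sum (\<lambda>y. y) (x / real n) - x / real n * ln (x / real n) - x / real n * euler_mascheroni))"
    using moebius_inversion_dilate[OF x, of "\<lambda>y. y"]
    by (simp add: M0_def M1_def right_diff_distrib sum_subtractf sum_distrib_left mult_ac)
  also have "\<bar>\<dots>\<bar> \<le> (\<Sum>n\<in>pnats x. 2)"
  proof (rule order_trans[OF sum_abs], rule sum_mono)
    fix n assume n: "n \<in> pnats x"
    let ?y = "x / real n"
    have "dilate_sum (\<lambda>y. y) ?y - ?y * ln ?y - ?y * euler_mascheroni =
       ?y * ((\<Sum>n\<in>pnats ?y. 1 / real n) - ln ?y - euler_mascheroni)"
      by (simp add: dilate_sum_pnats right_diff_distrib sum_distrib_left)
    also have "\<bar>\<dots>\<bar> \<le> ?y * (2 / ?y)"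
      unfolding abs_mult using pnatsD[OF n] harmonic_sum_asymp[of ?y]
      by (intro mult_mono) auto
    also have "\<dots> = 2" using pnatsD[OF n] by simp
    finally show "\<bar>moebius_mu n * (dilate_sum (\<lambda>y. y) ?y - ?y * ln ?y - ?y * euler_mascheroni)\<bar> \<le> 2"
      using abs_moebius_mu_le[of n] mult_mono[of "\<bar>moebius_mu n\<bar>" 1 _ 2] by (simp add: abs_mult)
  qed
  also have "\<dots> \<le> 2 * x" using card_pnats_le[of x] x by simp
  finally have 1: "\<bar>x - x * M1 - euler_mascheroni * x * M0\<bar> \<le> 2 * x" .
  have "\<bar>euler_mascheroni * x * M0\<bar> \<le> (euler_mascheroni * x) * 2"
    unfolding abs_mult using sum_moebius_mu_over_n_bounded[OF x] x euler_mascheroni_pos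
    by (intro mult_mono) (auto simp: M0_def)
  with 1 x have "\<bar>x * M1\<bar> \<le> x * (3 + 2 * euler_mascheroni)" by (simp add: algebra_simps)
  then show "\<bar>M1\<bar> \<le> 3 + 2 * euler_mascheroni" using x by (simp add: abs_mult)
qed

subsection \<open>The Tatuzawa--Iseki estimate\<close>

text \<open>
  For functions that are bounded on compact subintervals of \<open>[1, \<infinity>)\<close>, these say \<open>r(x) = o(x)\<close> and
  \<open>E(x) = o(x ln x)\<close>, in a form that is uniform on \<open>[1, \<infinity>)\<close>, so that it can be summed over the
  dilates \<open>x / n\<close>.
\<close>

definition sublin :: "(real \<Rightarrow> real) \<Rightarrow> bool" where
  "sublin r \<longleftrightarrow> (\<forall>\<epsilon>>0. \<exists>K. \<forall>x\<ge>1. \<bar>r x\<bar> \<le> \<epsilon> * x + K)"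

definition sublog :: "(real \<Rightarrow> real) \<Rightarrow> bool" where
  "sublog E \<longleftrightarrow> (\<forall>\<epsilon>>0. \<exists>K. \<forall>x\<ge>1. \<bar>E x\<bar> \<le> \<epsilon> * (x * ln x) + K * x)"

lemma sublinE:
  assumes "sublin r" "\<epsilon> > 0"
  obtains K where "K \<ge> 0" "\<And>x. x \<ge> 1 \<Longrightarrow> \<bar>r x\<bar> \<le> \<epsilon> * x + K"
proof -
  obtain K where K: "\<And>x. x \<ge> 1 \<Longrightarrow> \<bar>r x\<bar> \<le> \<epsilon> * x + K" using assms unfolding sublin_def by blast
  have "\<bar>r x\<bar> \<le> \<epsilon> * x + \<bar>K\<bar>" if "x \<ge> 1" for x using K[OF that] by linarith
  then show ?thesis by (intro that[of "\<bar>K\<bar>"]) auto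
qed

lemma sublogE:
  assumes "sublog E" "\<epsilon> > 0"
  obtains K where "K \<ge> 0" "\<And>x. x \<ge> 1 \<Longrightarrow> \<bar>E x\<bar> \<le> \<epsilon> * (x * ln x) + K * x"
proof -
  obtain K where K: "\<And>x. x \<ge> 1 \<Longrightarrow> \<bar>E x\<bar> \<le> \<epsilon> * (x * ln x) + K * x"
    using assms unfolding sublog_def by blast
  have "\<bar>E x\<bar> \<le> \<epsilon> * (x * ln x) + \<bar>K\<bar> * x" if "x \<ge> 1" for x
    using K[OF that] mult_right_mono[OF abs_ge_self, of x K] that by linarith
  then show ?thesis by (intro that[of "\<bar>K\<bar>"]) auto
qed

lemma sublin_add:
  assumes "sublin r" "sublin s"
  shows "sublin (\<lambda>x. r x + s x)"
  unfolding sublin_def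
proof (intro allI impI)
  fix \<epsilon> :: real assume e: "\<epsilon> > 0"
  obtain K where K: "\<And>x. x \<ge> 1 \<Longrightarrow> \<bar>r x\<bar> \<le> (\<epsilon>/2) * x + K" using sublinE[OF assms(1), of "\<epsilon>/2"] e by auto
  obtain L where L: "\<And>x. x \<ge> 1 \<Longrightarrow> \<bar>s x\<bar> \<le> (\<epsilon>/2) * x + L" using sublinE[OF assms(2), of "\<epsilon>/2"] e by auto
  have "\<bar>r x + s x\<bar> \<le> \<epsilon> * x + (K + L)" if "x \<ge> 1" for x
    using K[OF that] L[OF that] by simp
  then show "\<exists>K. \<forall>x\<ge>1. \<bar>r x + s x\<bar> \<le> \<epsilon> * x + K" by blast
qed

lemma sublog_add:
  assumes "sublog r" "sublog s"
  shows "sublog (\<lambda>x. r x + s x)"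
  unfolding sublog_def
proof (intro allI impI)
  fix \<epsilon> :: real assume e: "\<epsilon> > 0"
  obtain K where K: "\<And>x. x \<ge> 1 \<Longrightarrow> \<bar>r x\<bar> \<le> (\<epsilon>/2) * (x * ln x) + K * x" using sublogE[OF assms(1), of "\<epsilon>/2"] e by auto
  obtain L where L: "\<And>x. x \<ge> 1 \<Longrightarrow> \<bar>s x\<bar> \<le> (\<epsilon>/2) * (x * ln x) + L * x" using sublogE[OF assms(2), of "\<epsilon>/2"] e by auto
  have "\<bar>r x + s x\<bar> \<le> \<epsilon> * (x * ln x) + (K + L) * x" if "x \<ge> 1" for x
    using K[OF that] L[OF that] by (simp add: algebra_simps)
  then show "\<exists>K. \<forall>x\<ge>1. \<bar>r x + s x\<bar> \<le> \<epsilon> * (x * ln x) + K * x" by blast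
qed

lemma sublin_mono:
  assumes "sublin r" "\<And>x. x \<ge> 1 \<Longrightarrow> \<bar>s x\<bar> \<le> \<bar>r x\<bar>"
  shows "sublin s"
  using assms unfolding sublin_def by (meson order_trans)

lemma sublog_mono:
  assumes "sublog r" "\<And>x. x \<ge> 1 \<Longrightarrow> \<bar>s x\<bar> \<le> \<bar>r x\<bar>"
  shows "sublog s"
  using assms unfolding sublog_def by (meson order_trans)

lemma sublog_minus: "sublog r \<Longrightarrow> sublog (\<lambda>x. - r x)"
  by (erule sublog_mono) simp

lemma sublog_diff: "sublog r \<Longrightarrow> sublog s \<Longrightarrow> sublog (\<lambda>x. r x - s x)"
  using sublog_add[OF _ sublog_minus] by fastforce

lemma sublog_linear_bound:
  assumes "\<And>x. x \<ge> 1 \<Longrightarrow> \<bar>E x\<bar> \<le> K * x"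
  shows "sublog E"
  unfolding sublog_def
proof (intro allI impI exI)
  fix \<epsilon> x :: real assume "\<epsilon> > 0" "x \<ge> 1"
  then show "\<bar>E x\<bar> \<le> \<epsilon> * (x * ln x) + K * x"
    using assms[of x] by (smt (verit) ln_ge_zero mult_nonneg_nonneg)
qed

lemma ln_le_linear:
  fixes x :: real
  assumes "\<epsilon> > 0" "x > 0"
  shows "ln x \<le> \<epsilon> * x - ln \<epsilon>"
  using ln_le_minus_one[of "\<epsilon> * x"] assms by (simp add: ln_mult)

lemma sublin_ln: "sublin (\<lambda>x. c * ln x)"
  unfolding sublin_def
proof (intro allI impI)
  fix \<epsilon> :: real assume e: "\<epsilon> > 0"
  define \<delta> where "\<delta> = \<epsilon> / (\<bar>c\<bar> + 1)"
  have d: "\<delta> > 0" using e by (simp add: \<delta>_def add_nonneg_pos)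
  have cd: "\<bar>c\<bar> * \<delta> \<le> \<epsilon>" using e by (simp add: \<delta>_def field_simps)
  show "\<exists>K. \<forall>x\<ge>1. \<bar>c * ln x\<bar> \<le> \<epsilon> * x + K"
  proof (intro exI allI impI)
    fix x :: real assume x: "x \<ge> 1"
    have "\<bar>c * ln x\<bar> = \<bar>c\<bar> * ln x" using x by (simp add: abs_mult)
    also have "\<dots> \<le> \<bar>c\<bar> * (\<delta> * x - ln \<delta>)" using ln_le_linear[OF d, of x] x by (intro mult_left_mono) auto
    also have "\<dots> \<le> \<epsilon> * x + (- \<bar>c\<bar> * ln \<delta>)"
      using mult_right_mono[OF cd, of x] x by (simp add: algebra_simps)
    finally show "\<bar>c * ln x\<bar> \<le> \<epsilon> * x + (- \<bar>c\<bar> * ln \<delta>)" .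
  qed
qed

lemma harmonic_sum_le:
  assumes "x \<ge> 1"
  shows "(\<Sum>n\<in>pnats x. 1 / real n) \<le> ln x + (euler_mascheroni + 2)"
    "\<bar>(\<Sum>n\<in>pnats x. 1 / real n) - ln x\<bar> \<le> euler_mascheroni + 2"
proof -
  have "2 / x \<le> 2" using assms by (simp add: field_simps)
  then show *: "\<bar>(\<Sum>n\<in>pnats x. 1 / real n) - ln x\<bar> \<le> euler_mascheroni + 2"
    using harmonic_sum_asymp[OF assms] euler_mascheroni_pos by linarith
  then show "(\<Sum>n\<in>pnats x. 1 / real n) \<le> ln x + (euler_mascheroni + 2)" by linarith
qed

text \<open>Over the dilates \<open>x / n\<close>, the part \<open>\<epsilon> * (x / n)\<close> of
  the bound for \<open>r\<close> adds up to \<open>\<epsilon> * x\<close> times a harmonic sum,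
  which is of order \<open>ln x\<close>; the constant part adds up to at most
  \<open>K * x\<close>.\<close>

lemma sublog_sum_sublin:
  assumes "sublin r" "\<And>n. \<bar>a n\<bar> \<le> 1"
  shows "sublog (\<lambda>x. \<Sum>n\<in>pnats x. a n * r (x / real n))"
  unfolding sublog_def
proof (intro allI impI)
  fix \<epsilon> :: real assume e: "\<epsilon> > 0"
  obtain K where K: "K \<ge> 0" "\<And>x. x \<ge> 1 \<Longrightarrow> \<bar>r x\<bar> \<le> \<epsilon> * x + K" using sublinE[OF assms(1) e] by auto
  show "\<exists>K. \<forall>x\<ge>1. \<bar>\<Sum>n\<in>pnats x. a n * r (x / real n)\<bar> \<le> \<epsilon> * (x * ln x) + K * x"
  proof (intro exI allI impI)
    fix x :: real assume x: "x \<ge> 1"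
    have "\<bar>\<Sum>n\<in>pnats x. a n * r (x / real n)\<bar> \<le> (\<Sum>n\<in>pnats x. \<epsilon> * x * (1 / real n) + K)"
    proof (rule order_trans[OF sum_abs], rule sum_mono)
      fix n assume n: "n \<in> pnats x"
      have "\<bar>a n * r (x / real n)\<bar> \<le> 1 * (\<epsilon> * (x / real n) + K)"
        unfolding abs_mult using assms(2) K(2)[of "x / real n"] pnatsD[OF n] by (intro mult_mono) auto
      then show "\<bar>a n * r (x / real n)\<bar> \<le> \<epsilon> * x * (1 / real n) + K" by simp
    qed
    also have "\<dots> = \<epsilon> * x * (\<Sum>n\<in>pnats x. 1 / real n) + K * real (card (pnats x))"
      by (simp add: sum.distrib sum_distrib_left)
    also have "\<dots> \<le> \<epsilon> * x * (ln x + (euler_mascheroni + 2)) + K * x"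
      using harmonic_sum_le[OF x] card_pnats_le[of x] x e K(1) by (intro add_mono mult_left_mono) auto
    also have "\<dots> = \<epsilon> * (x * ln x) + (\<epsilon> * (euler_mascheroni + 2) + K) * x" by (simp add: algebra_simps)
    finally show "\<bar>\<Sum>n\<in>pnats x. a n * r (x / real n)\<bar> \<le> \<epsilon> * (x * ln x) + (\<epsilon> * (euler_mascheroni + 2) + K) * x" .
  qed
qed

text \<open>In the Tatuzawa-Iseki identity, \<open>ln y * dilate_sum g y\<close> is replaced by
  \<open>b * y * ln y + C * y\<close> plus a remainder. The two main terms produce \<open>x\<close>
  times the bounded Moebius sums, and the remainder is summed over the dilates. The hypothesis is
  multiplied through by \<open>ln y\<close>, so that it makes sense at \<open>y = 1\<close>.\<close>

lemma selberg_formula_general: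
  fixes g :: "real \<Rightarrow> real"
  assumes "sublin (\<lambda>y. ln y * dilate_sum g y - b * y * ln y - C * y)"
  shows "sublog (\<lambda>x. g x * ln x + (\<Sum>n\<in>pnats x. mangoldt n * g (x / real n)))"
proof -
  define r where "r = (\<lambda>y. ln y * dilate_sum g y - b * y * ln y - C * y)"
  obtain K where K: "\<And>x. x \<ge> 1 \<Longrightarrow> \<bar>\<Sum>n\<in>pnats x. moebius_mu n / real n * ln (x / real n)\<bar> \<le> K"
    using sum_moebius_mu_ln_over_n_bounded by blast
  define M where "M x = b * x * (\<Sum>n\<in>pnats x. moebius_mu n / real n * ln (x / real n)) +
      C * x * (\<Sum>n\<in>pnats x. moebius_mu n / real n)" for x
  have "sublog M"
  proof (rule sublog_linear_bound)
    fix x :: real assume x: "x \<ge> 1"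
    have "\<bar>M x\<bar> \<le> (\<bar>b\<bar> * x) * K + (\<bar>C\<bar> * x) * 2"
      unfolding M_def using K[OF x] sum_moebius_mu_over_n_bounded[OF x] x
      by (intro order_trans[OF abs_triangle_ineq] add_mono) (auto simp: abs_mult intro!: mult_left_mono)
    then show "\<bar>M x\<bar> \<le> (\<bar>b\<bar> * K + \<bar>C\<bar> * 2) * x" by (simp add: algebra_simps)
  qed
  moreover have "sublog (\<lambda>x. \<Sum>n\<in>pnats x. moebius_mu n * r (x / real n))"
    using assms abs_moebius_mu_le by (intro sublog_sum_sublin) (simp_all add: r_def)
  ultimately have "sublog (\<lambda>x. M x + (\<Sum>n\<in>pnats x. moebius_mu n * r (x / real n)))" by (rule sublog_add)
  then show ?thesis
  proof (rule sublog_mono)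
    fix x :: real assume x: "x \<ge> 1"
    have "M x + (\<Sum>n\<in>pnats x. moebius_mu n * r (x / real n)) =
          (\<Sum>n\<in>pnats x. b * x * (moebius_mu n / real n * ln (x / real n)) + C * x * (moebius_mu n / real n)
             + moebius_mu n * r (x / real n))"
      by (simp add: M_def sum.distrib sum_distrib_left)
    also have "\<dots> = (\<Sum>n\<in>pnats x. moebius_mu n * ln (x / real n) * dilate_sum g (x / real n))"
      by (rule sum.cong) (auto simp: r_def algebra_simps)
    finally show "\<bar>g x * ln x + (\<Sum>n\<in>pnats x. mangoldt n * g (x / real n))\<bar> \<le>
        \<bar>M x + (\<Sum>n\<in>pnats x. moebius_mu n * r (x / real n))\<bar>"
      using tatuzawa_iseki[OF x, of g] by simp
  qed
qed

section \<open>Dilate sums and growth of functions satisfying the hypothesis\<close>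

lemma dilate_sum_bounds:
  assumes nonneg: "\<And>x. x \<ge> 1 \<Longrightarrow> f x \<ge> 0" and mono: "mono_on {1..} f" and y: "1 \<le> y" "y \<le> Y"
  shows "0 \<le> dilate_sum f y" "dilate_sum f y \<le> Y * f Y"
proof -
  show "0 \<le> dilate_sum f y" unfolding dilate_sum_pnats
    by (intro sum_nonneg nonneg) (auto dest: pnatsD)
  have "dilate_sum f y \<le> (\<Sum>n\<in>pnats y. f Y)"
    unfolding dilate_sum_pnats
  proof (rule sum_mono)
    fix n assume "n \<in> pnats y"
    from pnatsD[OF this] show "f (y / real n) \<le> f Y"
      using y by (intro mono_onD[OF mono]) auto
  qed
  also have "\<dots> \<le> Y * f Y"
    using card_pnats_le[of y] y nonneg[of Y] by (auto intro!: mult_right_mono)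
  finally show "dilate_sum f y \<le> Y * f Y" .
qed

lemma dilate_sum_minus_linear: "dilate_sum (\<lambda>t. f t - A * t) y = dilate_sum f y - A * y * (\<Sum>n\<in>pnats y. 1 / real n)"
  by (simp add: dilate_sum_pnats sum_subtractf sum_distrib_left)

text \<open>The hypothesis, multiplied by \<open>ln y\<close> and made uniform on
  \<open>[1, \<infinity>)\<close>, is isolated here because it is used for two functions: the given
  \<open>f\<close> and the Chebyshev function \<open>psi\<close>.\<close>

locale selberg_function =
  fixes f :: "real \<Rightarrow> real" and A B C :: real
  assumes nonneg: "\<And>x. x \<ge> 1 \<Longrightarrow> f x \<ge> 0"
    and mono: "mono_on {1..} f"
    and sublin_dilate_sum: "sublin (\<lambda>y. ln y * dilate_sum f y - A * y * (ln y)\<^sup>2 - B * y * ln y - C * y)"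
begin

abbreviation rem :: "real \<Rightarrow> real" where "rem \<equiv> (\<lambda>x. f x - A * x)"

text \<open>The linear function \<open>A * t\<close> has dilate sum
  \<open>A * y * ln y + A * euler_mascheroni * y\<close> up to a bounded error. Subtracting it
  removes the leading term and shifts \<open>B\<close>; the error becomes a multiple of
  \<open>ln y\<close>, which is sublinear.\<close>

lemma dilate_sum_rem_sublin:
  "sublin (\<lambda>y. ln y * dilate_sum rem y - (B - A * euler_mascheroni) * y * ln y - C * y)"
proof -
  have "sublin (\<lambda>y. (ln y * dilate_sum f y - A * y * (ln y)\<^sup>2 - B * y * ln y - C * y) +
      (- A * y * ln y * ((\<Sum>n\<in>pnats y. 1 / real n) - ln y - euler_mascheroni)))"
  proof (intro sublin_add sublin_dilate_sum sublin_mono[OF sublin_ln[of "2 * A"]])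
    fix x :: real assume x: "x \<ge> 1"
    have "\<bar>- A * x * ln x * ((\<Sum>n\<in>pnats x. 1 / real n) - ln x - euler_mascheroni)\<bar> \<le>
        (\<bar>A\<bar> * x * ln x) * (2 / x)"
      unfolding abs_mult using harmonic_sum_asymp[OF x] x by (intro mult_mono) auto
    also have "\<dots> = \<bar>2 * A * ln x\<bar>" using x by (simp add: abs_mult)
    finally show "\<bar>- A * x * ln x * ((\<Sum>n\<in>pnats x. 1 / real n) - ln x - euler_mascheroni)\<bar> \<le> \<bar>2 * A * ln x\<bar>" .
  qed
  then show ?thesis
    unfolding dilate_sum_minus_linear by (rule sublin_mono) (simp add: algebra_simps power2_eq_square)
qed

text \<open>From \<open>exp 1\<close> on, \<open>ln x \<ge> 1\<close> can be divided out of the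
  hypothesis; below \<open>exp 1\<close> monotonicity of \<open>f\<close> bounds the dilate
  sum.\<close>

lemma dilate_sum_bound:
  obtains K where "K \<ge> 0" "\<And>x. x \<ge> 1 \<Longrightarrow> \<bar>dilate_sum f x - A * x * ln x\<bar> \<le> K * x"
proof -
  obtain K where K: "K \<ge> 0" "\<And>y. y \<ge> 1 \<Longrightarrow>
      \<bar>ln y * dilate_sum f y - A * y * (ln y)\<^sup>2 - B * y * ln y - C * y\<bar> \<le> 1 * y + K"
    using sublinE[OF sublin_dilate_sum, of 1] by auto
  define L where "L = \<bar>B\<bar> + \<bar>C\<bar> + 1 + K + exp 1 * f (exp 1) + \<bar>A\<bar>"
  have fe: "exp 1 * f (exp 1) \<ge> 0" using nonneg[of "exp 1"] by simp
  show ?thesis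
  proof (rule that)
    show "L \<ge> 0" using K fe by (simp add: L_def)
    fix x :: real assume x: "x \<ge> 1"
    show "\<bar>dilate_sum f x - A * x * ln x\<bar> \<le> L * x"
    proof (cases "x \<ge> exp 1")
      case True
      then have l: "ln x \<ge> 1" using x by (simp add: ln_ge_iff)
      let ?D = "dilate_sum f x - A * x * ln x - B * x"
      have "ln x * ?D - C * x = ln x * dilate_sum f x - A * x * (ln x)\<^sup>2 - B * x * ln x - C * x"
        by (simp add: algebra_simps power2_eq_square)
      then have "\<bar>ln x * ?D - C * x\<bar> \<le> x + K" using K(2)[OF x] by simp
      moreover have "\<bar>C * x\<bar> = \<bar>C\<bar> * x" using x by (simp add: abs_mult)
      ultimately have "\<bar>ln x * ?D\<bar> \<le> x + K + \<bar>C\<bar> * x" by linarith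
      moreover have "\<bar>?D\<bar> \<le> \<bar>ln x * ?D\<bar>" using l mult_right_mono[of 1 "ln x" "\<bar>?D\<bar>"] by (simp add: abs_mult)
      moreover have "\<bar>B * x\<bar> = \<bar>B\<bar> * x" using x by (simp add: abs_mult)
      ultimately have "\<bar>dilate_sum f x - A * x * ln x\<bar> \<le> \<bar>B\<bar> * x + \<bar>C\<bar> * x + x + K" by linarith
      also have "K \<le> K * x" using K x by (simp add: mult_le_cancel_left1)
      also have "\<bar>B\<bar> * x + \<bar>C\<bar> * x + x + K * x = (\<bar>B\<bar> + \<bar>C\<bar> + 1 + K) * x" by (simp add: algebra_simps)
      also have "\<dots> \<le> L * x" using x fe by (intro mult_right_mono) (auto simp: L_def)
      finally show ?thesis by simp
    next
      case False
      then have "ln x \<le> ln (exp 1)" using x by (subst ln_le_cancel_iff) auto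
      then have l: "ln x \<le> 1" "ln x \<ge> 0" "x \<le> exp 1" using x False by auto
      note F = dilate_sum_bounds[OF nonneg mono x l(3)]
      have "\<bar>A * x * ln x\<bar> \<le> \<bar>A\<bar> * x * 1" unfolding abs_mult using l x by (intro mult_mono) auto
      moreover have "exp 1 * f (exp 1) \<le> exp 1 * f (exp 1) * x" using fe x by (simp add: mult_le_cancel_left1)
      ultimately have "\<bar>dilate_sum f x - A * x * ln x\<bar> \<le> (exp 1 * f (exp 1) + \<bar>A\<bar>) * x"
        using F unfolding distrib_right by linarith
      also have "\<dots> \<le> L * x" using x K by (intro mult_right_mono) (auto simp: L_def)
      finally show ?thesis .
    qed
  qed
qed

lemma dilate_sum_rem_bound:
  obtains K where "\<And>x. x \<ge> 1 \<Longrightarrow> \<bar>dilate_sum rem x\<bar> \<le> K * x"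
proof -
  obtain K where K: "\<And>x. x \<ge> 1 \<Longrightarrow> \<bar>dilate_sum f x - A * x * ln x\<bar> \<le> K * x" using dilate_sum_bound by blast
  show ?thesis
  proof (rule that)
    fix x :: real assume x: "x \<ge> 1"
    have "dilate_sum rem x = (dilate_sum f x - A * x * ln x) - A * x * ((\<Sum>n\<in>pnats x. 1 / real n) - ln x)"
      unfolding dilate_sum_minus_linear by (simp add: right_diff_distrib)
    also have "\<bar>\<dots>\<bar> \<le> K * x + \<bar>A\<bar> * x * (euler_mascheroni + 2)"
    proof (rule order_trans[OF abs_triangle_ineq4], rule add_mono)
      show "\<bar>A * x * ((\<Sum>n\<in>pnats x. 1 / real n) - ln x)\<bar> \<le> \<bar>A\<bar> * x * (euler_mascheroni + 2)"
        using harmonic_sum_le(2)[OF x] x by (auto simp: abs_mult intro!: mult_left_mono)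
    qed (rule K[OF x])
    finally show "\<bar>dilate_sum rem x\<bar> \<le> (K + \<bar>A\<bar> * (euler_mascheroni + 2)) * x" by (simp add: algebra_simps)
  qed
qed

text \<open>
  Chebyshev's argument: \<open>F(x) - 2 F(x/2) = f(x) - f(x/2) + f(x/3) - \<dots>\<close> has decreasing terms.
\<close>

lemma dilate_sum_minus_double:
  assumes x: "x \<ge> 2"
  shows "f x - f (x / 2) \<le> dilate_sum f x - 2 * dilate_sum f (x / 2)"
proof -
  let ?S = "pnats (x / 2)"
  have S: "1 \<le> m" "2 * real m \<le> x" if "m \<in> ?S" for m using pnatsD[OF that] by auto
  \<comment> \<open>The odd indices \<open>2 * m - 1\<close> and the even indices
    \<open>2 * m\<close> are disjoint subsets of \<open>pnats x\<close>. At most a last odd index is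
    missed, and its term is non-negative.\<close>
  have "(\<Sum>m\<in>?S. f (x / real (2*m - 1)) + f (x / real (2*m))) =
        (\<Sum>n\<in>(\<lambda>m. 2*m - 1) ` ?S. f (x / real n)) + (\<Sum>n\<in>(\<lambda>m. 2*m) ` ?S. f (x / real n))"
  proof -
    have i1: "inj_on (\<lambda>m::nat. 2*m - 1) ?S"
    proof (rule inj_onI)
      fix a b assume "a \<in> ?S" "b \<in> ?S" "2*a - 1 = 2*b - 1"
      then show "a = b" using S(1)[of a] S(1)[of b] by linarith
    qed
    have i2: "inj_on (\<lambda>m::nat. 2*m) ?S" by (auto intro: inj_onI)
    show ?thesis unfolding sum.reindex[OF i1] sum.reindex[OF i2] o_def by (rule sum.distrib)
  qed
  also have "\<dots> = (\<Sum>n\<in>(\<lambda>m. 2*m - 1) ` ?S \<union> (\<lambda>m. 2*m) ` ?S. f (x / real n))"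
  proof (rule sum.union_disjoint[symmetric])
    have "2*a - 1 \<noteq> 2*b" if "a \<in> ?S" for a b :: nat using S(1)[OF that] by presburger
    then show "(\<lambda>m. 2*m - 1) ` ?S \<inter> (\<lambda>m. 2*m) ` ?S = {}" by blast
  qed auto
  also have "\<dots> \<le> (\<Sum>n\<in>pnats x. f (x / real n))"
  proof (rule sum_mono2)
    have "2*m - 1 \<in> pnats x" "2*m \<in> pnats x" if "m \<in> ?S" for m
      using S[OF that] unfolding pnats_def by (auto simp: of_nat_diff)
    then show "(\<lambda>m. 2*m - 1) ` ?S \<union> (\<lambda>m. 2*m) ` ?S \<subseteq> pnats x" by blast
  qed (auto intro!: nonneg dest: pnatsD)
  finally have 1: "(\<Sum>m\<in>?S. f (x / real (2*m - 1)) + f (x / real (2*m))) \<le> dilate_sum f x"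
    by (simp add: dilate_sum_pnats)
  \<comment> \<open>The left side is the pair \<open>m = 1\<close>; the other pairs are non-negative
    by monotonicity.\<close>
  have "f x - f (x / 2) \<le> (\<Sum>m\<in>?S. f (x / real (2*m - 1)) - f (x / real (2*m)))"
  proof -
    have "f x - f (x / 2) = (\<Sum>m\<in>{1}. f (x / real (2*m - 1)) - f (x / real (2*m)))" by simp
    also have "\<dots> \<le> (\<Sum>m\<in>?S. f (x / real (2*m - 1)) - f (x / real (2*m)))"
    proof (rule sum_mono2)
      show "{1} \<subseteq> ?S" using one_in_pnats[of "x/2"] x by auto
      fix m assume "m \<in> ?S - {1}"
      then have m: "1 \<le> m" "2 * real m \<le> x" using S by auto
      have "1 \<le> x / real (2*m)" using m by (simp add: field_simps)
      moreover have "x / real (2*m) \<le> x / real (2*m - 1)" using m x by (intro divide_left_mono) auto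
      ultimately show "0 \<le> f (x / real (2*m - 1)) - f (x / real (2*m))"
        using mono_onD[OF mono, of "x / real (2*m)" "x / real (2*m - 1)"] by auto
    qed simp
    finally show ?thesis .
  qed
  \<comment> \<open>The even terms \<open>f (x / (2 * m))\<close> are exactly those of the dilate
    sum at \<open>x / 2\<close>, so reversing their sign subtracts it twice.\<close>
  also have "\<dots> = (\<Sum>m\<in>?S. f (x / real (2*m - 1)) + f (x / real (2*m))) - 2 * dilate_sum f (x / 2)"
    by (simp add: dilate_sum_pnats sum.distrib sum_subtractf sum_distrib_left)
  finally show ?thesis using 1 by linarith
qed

text \<open>In \<open>dilate_sum f x - 2 * dilate_sum f (x / 2)\<close> the terms of order
  \<open>x * ln x\<close> cancel, so \<open>f x - f (x / 2)\<close> is at most linear. Repeated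
  halving down to the interval \<open>[1, 2)\<close> sums a geometric series.\<close>

lemma linear_bound:
  obtains K where "K \<ge> 0" "\<And>x. x \<ge> 1 \<Longrightarrow> f x \<le> K * x"
proof -
  obtain K where K: "K \<ge> 0" "\<And>x. x \<ge> 1 \<Longrightarrow> \<bar>dilate_sum f x - A * x * ln x\<bar> \<le> K * x" using dilate_sum_bound by blast
  define L where "L = \<bar>A\<bar> * ln 2 + 2 * K"
  have L0: "L \<ge> 0" using K by (simp add: L_def)
  have step: "f x \<le> L * x + f (x / 2)" if x: "x \<ge> 2" for x
  proof -
    have "f x - f (x / 2) \<le> dilate_sum f x - 2 * dilate_sum f (x / 2)" by (rule dilate_sum_minus_double[OF x])
    also have "\<dots> \<le> (A * x * ln x + K * x) - 2 * (A * (x/2) * ln (x/2) - K * (x/2))"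
      using K(2)[of x] K(2)[of "x/2"] x unfolding abs_le_iff by (intro diff_mono mult_left_mono) auto
    also have "\<dots> = (A * ln 2 + 2 * K) * x" using x by (simp add: ln_div field_simps)
    also have "\<dots> \<le> L * x" using x by (intro mult_right_mono) (auto simp: L_def mult_right_mono)
    finally show ?thesis by simp
  qed
  \<comment> \<open>This constant serves both cases of the induction: \<open>f 2 \<le> M\<close> on
    \<open>[1, 2)\<close>, and \<open>L + M / 2 \<le> M\<close> for the halving step.\<close>
  define M where "M = 2 * L + f 2"
  have M0: "M \<ge> 0" using L0 nonneg[of 2] by (simp add: M_def)
  have "\<forall>x. 1 \<le> x \<and> x < 2 ^ n \<longrightarrow> f x \<le> M * x" for n
  proof (induction n)
    case (Suc n)
    show ?case
    proof (intro allI impI)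
      fix x :: real assume x: "1 \<le> x \<and> x < 2 ^ Suc n"
      show "f x \<le> M * x"
      proof (cases "x < 2")
        case True
        then have "f x \<le> f 2" using x by (intro mono_onD[OF mono]) auto
        also have "\<dots> \<le> M" using L0 by (simp add: M_def)
        also have "\<dots> \<le> M * x" using M0 x by (simp add: mult_le_cancel_left1)
        finally show ?thesis .
      next
        case False
        have "f x \<le> L * x + f (x / 2)" using step False by simp
        also have "f (x / 2) \<le> M * (x / 2)" using Suc[rule_format, of "x / 2"] x False by simp
        also have "L * x + M * (x / 2) = (L + M / 2) * x" by (simp add: algebra_simps)
        also have "\<dots> \<le> M * x" using x nonneg[of 2] by (intro mult_right_mono) (auto simp: M_def)
        finally show ?thesis by simp
      qed
    qed
  qed simp
  then have "f x \<le> M * x" if "x \<ge> 1" for x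
    using that real_arch_pow[of 2 x] by auto
  with M0 show ?thesis using that by blast
qed

end

subsection \<open>The Chebyshev function\<close>

lemma pnats_mono: "x \<le> y \<Longrightarrow> pnats x \<subseteq> pnats y"
  by (auto simp: pnats_def)

definition psi :: "real \<Rightarrow> real" where
  "psi x = (\<Sum>n\<in>pnats x. mangoldt n)"

lemma psi_nonneg: "psi x \<ge> 0"
  unfolding psi_def by (intro sum_nonneg mangoldt_nonneg)

lemma psi_mono: "x \<le> y \<Longrightarrow> psi x \<le> psi y"
  unfolding psi_def by (intro sum_mono2 pnats_mono mangoldt_nonneg) auto

lemma sum_dvd_flip:
  fixes F :: "nat \<Rightarrow> real"
  assumes "k > (0::nat)"
  shows "(\<Sum>d | d dvd k. F (k div d)) = (\<Sum>d | d dvd k. F d)"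
  by (rule sum.reindex_bij_witness[where i="\<lambda>d. k div d" and j="\<lambda>d. k div d"])
     (use assms in \<open>auto elim!: dvdE\<close>)

text \<open>Chebyshev's identity: the divisor sum of \<open>mangoldt\<close> is \<open>ln\<close>,
  so both sides are the logarithm of the factorial of the integer part of \<open>x\<close>.\<close>

lemma dilate_sum_psi: "dilate_sum psi x = (\<Sum>k\<in>pnats x. ln (real k))"
proof -
  have "dilate_sum psi x = (\<Sum>k\<in>pnats x. (\<Sum>d | d dvd k. 1 * mangoldt (k div d)) * 1)"
    using dilate_convolve[where a="\<lambda>_. 1" and b=mangoldt and g="\<lambda>_. 1" and x=x]
    by (simp add: dilate_sum_pnats psi_def)
  also have "\<dots> = (\<Sum>k\<in>pnats x. ln (real k))"
  proof (rule sum.cong[OF refl])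
    fix k assume "k \<in> pnats x"
    from pnatsD[OF this] show "(\<Sum>d | d dvd k. 1 * mangoldt (k div d)) * 1 = ln (real k)"
      using sum_dvd_flip[of k mangoldt] mangoldt_sum[of k, where 'a=real] by simp
  qed
  finally show ?thesis .
qed

lemma sum_ln_mangoldt: "(\<Sum>k\<in>pnats x. ln (real k)) = (\<Sum>n\<in>pnats x. mangoldt n * real (card (pnats (x / real n))))"
proof -
  have "(\<Sum>n\<in>pnats x. mangoldt n * real (card (pnats (x / real n)))) =
        (\<Sum>k\<in>pnats x. (\<Sum>d | d dvd k. mangoldt d * 1) * 1)"
    using dilate_convolve[where b="\<lambda>_. 1" and a=mangoldt and g="\<lambda>_. 1" and x=x] by simp
  also have "\<dots> = (\<Sum>k\<in>pnats x. ln (real k))"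
  proof (rule sum.cong[OF refl])
    fix k assume "k \<in> pnats x"
    from pnatsD[OF this] show "(\<Sum>d | d dvd k. mangoldt d * 1) * 1 = ln (real k)"
      using mangoldt_sum[of k, where 'a=real] by simp
  qed
  finally show ?thesis by simp
qed

text \<open>Since \<open>t * ln t - t\<close> is an antiderivative of \<open>ln\<close>, this
  compares an integral of \<open>ln\<close> with its smallest and largest rectangle. The proof needs
  only \<open>ln t \<le> t - 1\<close>, at \<open>t = b / a\<close> and
  \<open>t = a / b\<close>.\<close>

lemma x_ln_x_increment:
  fixes a b :: real
  assumes "0 < a" "a \<le> b"
  shows "(b - a) * ln a \<le> (b * ln b - b) - (a * ln a - a)"
    "(b * ln b - b) - (a * ln a - a) \<le> (b - a) * ln b"
proof -
  have "ln (b / a) \<le> b / a - 1" "ln (a / b) \<le> a / b - 1" using assms by (intro ln_le_minus_one; simp)+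
  then have "a * (ln b - ln a) \<le> a * (b / a - 1)" "b * (ln a - ln b) \<le> b * (a / b - 1)"
    using assms by (auto simp: ln_div intro!: mult_left_mono)
  then have "a * (ln b - ln a) \<le> b - a" "b * (ln a - ln b) \<le> a - b" using assms by (auto simp: right_diff_distrib)
  then show "(b - a) * ln a \<le> (b * ln b - b) - (a * ln a - a)"
    "(b * ln b - b) - (a * ln a - a) \<le> (b - a) * ln b" by (auto simp: algebra_simps)
qed

lemma sum_ln_nat_bounds:
  assumes "N \<ge> 1"
  shows "real N * ln (real N) - real N + 1 \<le> (\<Sum>k=1..N. ln (real k)) \<and>
         (\<Sum>k=1..N. ln (real k)) \<le> real N * ln (real N) - real N + 1 + ln (real N)"
  using assms
proof (induction N rule: dec_induct)
  case (step N)
  then show ?case using x_ln_x_increment[of "real N" "real (Suc N)"] by (simp add: algebra_simps)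
qed simp

lemma sum_ln_asymp:
  assumes "x \<ge> 1"
  shows "\<bar>(\<Sum>k\<in>pnats x. ln (real k)) - x * ln x + x\<bar> \<le> 1 + ln x"
proof -
  define N where "N = nat \<lfloor>x\<rfloor>"
  have N: "N \<ge> 1" "real N \<le> x" "x - real N \<le> 1" using assms unfolding N_def by linarith+
  have le: "ln (real N) \<le> ln x" using N assms by simp
  have "(x - real N) * ln x \<le> 1 * ln x" using N assms by (intro mult_right_mono) auto
  moreover have "(x - real N) * ln (real N) \<ge> 0" using N by simp
  ultimately show ?thesis
    using sum_ln_nat_bounds[OF N(1)] x_ln_x_increment[of "real N" x] N le
    unfolding pnats_eq N_def[symmetric] by linarith
qed

text \<open>The linear bound for \<open>ln\<close> is applied at \<open>sqrt x\<close> and squared.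
  The choice of \<open>\<delta>\<close> makes up for a factor 4 from
  \<open>ln x = 2 * ln (sqrt x)\<close> and a factor 2 from squaring a difference.\<close>

lemma sublin_ln_squared: "sublin (\<lambda>x. (ln x)\<^sup>2)"
  unfolding sublin_def
proof (intro allI impI)
  fix \<epsilon> :: real assume e: "\<epsilon> > 0"
  define \<delta> where "\<delta> = sqrt (\<epsilon> / 8)"
  have d: "\<delta> > 0" "\<delta>\<^sup>2 = \<epsilon> / 8" using e by (auto simp: \<delta>_def)
  show "\<exists>K. \<forall>x\<ge>1. \<bar>(ln x)\<^sup>2\<bar> \<le> \<epsilon> * x + K"
  proof (intro exI allI impI)
    fix x :: real assume x: "x \<ge> 1"
    have "0 \<le> ln (sqrt x)" "ln (sqrt x) \<le> \<delta> * sqrt x - ln \<delta>" using ln_le_linear[OF d(1), of "sqrt x"] x by auto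
    then have "(ln (sqrt x))\<^sup>2 \<le> (\<delta> * sqrt x - ln \<delta>)\<^sup>2" by (intro power_mono)
    also have "\<dots> \<le> 2 * (\<delta> * sqrt x)\<^sup>2 + 2 * (ln \<delta>)\<^sup>2"
      using zero_le_power2[of "\<delta> * sqrt x + ln \<delta>"] by (simp add: power2_eq_square algebra_simps)
    also have "\<dots> = \<epsilon> / 4 * x + 2 * (ln \<delta>)\<^sup>2" using x d by (simp add: power_mult_distrib)
    finally have "(ln x)\<^sup>2 \<le> \<epsilon> * x + 8 * (ln \<delta>)\<^sup>2" using x by (simp add: ln_sqrt power_divide)
    then show "\<bar>(ln x)\<^sup>2\<bar> \<le> \<epsilon> * x + 8 * (ln \<delta>)\<^sup>2" by simp
  qed
qed

text \<open>By Stirling's formula the dilate sum of \<open>psi\<close> is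
  \<open>x * ln x - x\<close> with an error of at most \<open>1 + ln x\<close>; multiplied by
  \<open>ln x\<close> this error is still sublinear.\<close>

interpretation psi: selberg_function psi 1 "-1" 0
proof
  show "sublin (\<lambda>y. ln y * dilate_sum psi y - 1 * y * (ln y)\<^sup>2 - - 1 * y * ln y - 0 * y)"
  proof (rule sublin_mono[OF sublin_add[OF sublin_ln[of 1] sublin_ln_squared]])
    fix x :: real assume x: "x \<ge> 1"
    have "ln x * dilate_sum psi x - 1 * x * (ln x)\<^sup>2 - - 1 * x * ln x - 0 * x =
        ln x * ((\<Sum>k\<in>pnats x. ln (real k)) - x * ln x + x)"
      by (simp add: dilate_sum_psi algebra_simps power2_eq_square)
    also have "\<bar>\<dots>\<bar> \<le> ln x * (1 + ln x)"
      unfolding abs_mult using sum_ln_asymp[OF x] x by (intro mult_mono) auto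
    also have "\<dots> = \<bar>1 * ln x + (ln x)\<^sup>2\<bar>" using x by (simp add: power2_eq_square algebra_simps)
    finally show "\<bar>ln x * dilate_sum psi x - 1 * x * (ln x)\<^sup>2 - - 1 * x * ln x - 0 * x\<bar> \<le> \<bar>1 * ln x + (ln x)\<^sup>2\<bar>" .
  qed
qed (auto simp: psi_nonneg psi_mono intro!: mono_onI)

text \<open>Mertens' first theorem, multiplied by \<open>x\<close>. In the expression of the
  log-factorial through \<open>mangoldt\<close>, replacing the number of multiples of
  \<open>n\<close> up to \<open>x\<close> by \<open>x / n\<close> costs at most
  \<open>mangoldt n\<close> per term, hence \<open>psi x\<close> in all, which is at most
  linear.\<close>

lemma mertens:
  obtains K where "\<And>x. x \<ge> 1 \<Longrightarrow> \<bar>x * (\<Sum>n\<in>pnats x. mangoldt n / real n) - x * ln x\<bar> \<le> K * x"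
proof -
  obtain K where K: "\<And>x. x \<ge> 1 \<Longrightarrow> psi x \<le> K * x" using psi.linear_bound by blast
  show ?thesis
  proof (rule that)
    fix x :: real assume x: "x \<ge> 1"
    have "x * (\<Sum>n\<in>pnats x. mangoldt n / real n) - (\<Sum>k\<in>pnats x. ln (real k)) =
        (\<Sum>n\<in>pnats x. mangoldt n * (x / real n - real (card (pnats (x / real n)))))"
      unfolding sum_ln_mangoldt by (simp add: sum_distrib_left right_diff_distrib sum_subtractf mult_ac)
    also have "\<bar>\<dots>\<bar> \<le> (\<Sum>n\<in>pnats x. mangoldt n)"
    proof (rule order_trans[OF sum_abs], rule sum_mono)
      fix n assume n: "n \<in> pnats x"
      have "\<bar>x / real n - real (card (pnats (x / real n)))\<bar> \<le> 1"
        using card_pnats_le[of "x / real n"] card_pnats_ge[of "x / real n"] pnatsD[OF n] by auto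
      then have "\<bar>mangoldt n * (x / real n - real (card (pnats (x / real n))))\<bar> \<le> mangoldt n * 1"
        unfolding abs_mult abs_mangoldt by (intro mult_left_mono mangoldt_nonneg)
      then show "\<bar>mangoldt n * (x / real n - real (card (pnats (x / real n))))\<bar> \<le> mangoldt n" by simp
    qed
    also have "\<dots> \<le> K * x" using K[OF x] by (simp add: psi_def)
    finally have "\<bar>x * (\<Sum>n\<in>pnats x. mangoldt n / real n) - x * ln x\<bar> \<le> K * x + 3 * x"
      using sum_ln_asymp[OF x] ln_le_minus_one[of x] x unfolding abs_le_iff by linarith
    then show "\<bar>x * (\<Sum>n\<in>pnats x. mangoldt n / real n) - x * ln x\<bar> \<le> (K + 3) * x" by (simp add: distrib_right)
  qed
qed

text \<open>
  Split at \<open>n = \<delta> x\<close>: the terms with \<open>n \<le> \<delta> x\<close> contribute at most \<open>K \<delta> x ln x\<close>, for the others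
  \<open>ln (x / n)\<close> is bounded.
\<close>

lemma sublog_sum_ln_quotient:
  fixes a :: "nat \<Rightarrow> real"
  assumes a: "\<And>n. a n \<ge> 0" and K: "\<And>x. x \<ge> 1 \<Longrightarrow> (\<Sum>n\<in>pnats x. a n) \<le> K * x"
  shows "sublog (\<lambda>x. \<Sum>n\<in>pnats x. a n * ln (x / real n))"
  unfolding sublog_def
proof (intro allI impI)
  fix \<epsilon> :: real assume e: "\<epsilon> > 0"
  have K0: "K \<ge> 0" using K[of 1] sum_nonneg[of "pnats 1" a] a by auto
  \<comment> \<open>The quotient gives \<open>K * \<delta> \<le> \<epsilon>\<close>, with
    \<open>K + 1\<close> in place of \<open>K\<close> to avoid a zero denominator. The bound 1
    ensures that the cut lies below \<open>x\<close> and that \<open>ln (1 / \<delta>)\<close> is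
    non-negative.\<close>
  define \<delta> where "\<delta> = min 1 (\<epsilon> / (K + 1))"
  have d: "\<delta> > 0" "\<delta> \<le> 1" using e K0 by (auto simp: \<delta>_def)
  have "K * \<delta> \<le> K * (\<epsilon> / (K + 1))" using K0 by (intro mult_left_mono) (auto simp: \<delta>_def)
  also have "\<dots> \<le> \<epsilon>" using K0 e by (simp add: field_simps)
  finally have Kd: "K * \<delta> \<le> \<epsilon>" .
  show "\<exists>K. \<forall>x\<ge>1. \<bar>\<Sum>n\<in>pnats x. a n * ln (x / real n)\<bar> \<le> \<epsilon> * (x * ln x) + K * x"
  proof (intro exI allI impI)
    fix x :: real assume x: "x \<ge> 1"
    have sub: "pnats (\<delta> * x) \<subseteq> pnats x" using d x by (intro pnats_mono) (simp add: mult_le_cancel_right2)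
    have "\<bar>\<Sum>n\<in>pnats x. a n * ln (x / real n)\<bar> = (\<Sum>n\<in>pnats x. a n * ln (x / real n))"
      using a by (intro abs_of_nonneg sum_nonneg mult_nonneg_nonneg ln_ge_zero) (auto dest: pnatsD)
    also have "\<dots> \<le> (\<Sum>n\<in>pnats x. (if n \<in> pnats (\<delta> * x) then a n * ln x else 0) + a n * ln (1 / \<delta>))"
    proof (rule sum_mono)
      fix n assume n: "n \<in> pnats x"
      note n' = pnatsD[OF n]
      have l: "ln (1 / \<delta>) \<ge> 0" using d by (intro ln_ge_zero) auto
      show "a n * ln (x / real n) \<le> (if n \<in> pnats (\<delta> * x) then a n * ln x else 0) + a n * ln (1 / \<delta>)"
      proof (cases "n \<in> pnats (\<delta> * x)")
        case True
        have "ln (x / real n) \<le> ln x" using n' by simp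
        then have "a n * ln (x / real n) \<le> a n * ln x" using a by (intro mult_left_mono)
        moreover have "a n * ln (1 / \<delta>) \<ge> 0" using a l by simp
        ultimately show ?thesis using True by simp
      next
        case False
        then have "x / real n \<le> 1 / \<delta>" using n' d by (auto simp: pnats_def field_simps)
        then have "ln (x / real n) \<le> ln (1 / \<delta>)" using n' d by (subst ln_le_cancel_iff) auto
        then show ?thesis using False a by (simp add: mult_left_mono)
      qed
    qed
    also have "\<dots> = (\<Sum>n\<in>pnats (\<delta> * x). a n) * ln x + (\<Sum>n\<in>pnats x. a n) * ln (1 / \<delta>)"
      using sub by (simp add: sum.distrib sum_distrib_right sum.inter_restrict[symmetric] Int_absorb1 Int_absorb2)
    also have "(\<Sum>n\<in>pnats (\<delta> * x). a n) \<le> K * (\<delta> * x)"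
    \<comment> \<open>The hypothesis on \<open>a\<close> covers only arguments from 1 on; below 1
      the sum is empty.\<close>
    proof (cases "\<delta> * x \<ge> 1")
      case False
      then have "pnats (\<delta> * x) = {}" by (auto dest: pnatsD)
      then show ?thesis using K0 d x by simp
    qed (rule K)
    also have "K * (\<delta> * x) = (K * \<delta>) * x" by simp
    also have "\<dots> \<le> \<epsilon> * x" using Kd x by (intro mult_right_mono) auto
    also have "(\<Sum>n\<in>pnats x. a n) \<le> K * x" by (rule K[OF x])
    finally have "\<bar>\<Sum>n\<in>pnats x. a n * ln (x / real n)\<bar> \<le> \<epsilon> * x * ln x + K * x * ln (1 / \<delta>)"
      using x d by (simp add: mult_right_mono ln_ge_zero)
    then show "\<bar>\<Sum>n\<in>pnats x. a n * ln (x / real n)\<bar> \<le> \<epsilon> * (x * ln x) + (K * ln (1 / \<delta>)) * x" by (simp add: mult_ac)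
  qed
qed

subsection \<open>Selberg's formula\<close>

definition mangoldt_conv :: "nat \<Rightarrow> real" where
  "mangoldt_conv n = (\<Sum>d | d dvd n. mangoldt d * mangoldt (n div d))"

text \<open>For positive \<open>n\<close> this is the von Mangoldt function of order two, the
  Dirichlet convolution of \<open>moebius_mu\<close> with the square of \<open>ln\<close>.\<close>

definition selberg_weight :: "nat \<Rightarrow> real" where
  "selberg_weight n = mangoldt n * ln (real n) + mangoldt_conv n"

lemma mangoldt_conv_nonneg: "mangoldt_conv n \<ge> 0"
  unfolding mangoldt_conv_def by (intro sum_nonneg mult_nonneg_nonneg mangoldt_nonneg)

lemma selberg_weight_nonneg: "selberg_weight n \<ge> 0"
  unfolding selberg_weight_def using mangoldt_conv_nonneg[of n] mangoldt_nonneg[of n]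
  by (cases "n = 0") auto

lemma selberg_weight_1: "selberg_weight (Suc 0) = 0"
  by (simp add: selberg_weight_def mangoldt_conv_def)

lemma sum_mangoldt_psi: "(\<Sum>n\<in>pnats x. mangoldt n * psi (x / real n)) = (\<Sum>n\<in>pnats x. mangoldt_conv n)"
  using dilate_convolve[where b=mangoldt and a=mangoldt and g="\<lambda>_. 1" and x=x]
  by (simp add: psi_def mangoldt_conv_def)

text \<open>The general formula is applied to \<open>psi\<close>, whose remainder is
  \<open>psi x - x\<close>. Passing from \<open>psi x * ln x\<close> to the sum of
  \<open>mangoldt n * ln n\<close> costs the sum of \<open>mangoldt n * ln (x / n)\<close>, which is
  \<open>sublog\<close>. By Mertens' theorem the linear part of the remainder inside the sum
  supplies the second \<open>x * ln x\<close>.\<close>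

lemma selberg_formula: "sublog (\<lambda>x. (\<Sum>n\<in>pnats x. selberg_weight n) - 2 * x * ln x)"
proof -
  obtain K where K: "\<And>x. x \<ge> 1 \<Longrightarrow> psi x \<le> K * x" using psi.linear_bound by blast
  obtain L where L: "\<And>x. x \<ge> 1 \<Longrightarrow> \<bar>x * (\<Sum>n\<in>pnats x. mangoldt n / real n) - x * ln x\<bar> \<le> L * x" using mertens by blast
  have "sublog (\<lambda>x. ((psi x - 1 * x) * ln x + (\<Sum>n\<in>pnats x. mangoldt n * (psi (x / real n) - 1 * (x / real n))))
      - (\<Sum>n\<in>pnats x. mangoldt n * ln (x / real n)) + (x * (\<Sum>n\<in>pnats x. mangoldt n / real n) - x * ln x))"
    using sublog_sum_ln_quotient[of mangoldt K, OF mangoldt_nonneg K[unfolded psi_def]]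
    by (rule sublog_add[OF sublog_diff[OF selberg_formula_general[OF psi.dilate_sum_rem_sublin]]
          sublog_linear_bound[OF L]])
  then show ?thesis
  proof (rule sublog_mono)
    fix x :: real assume x: "x \<ge> 1"
    have 1: "(\<Sum>n\<in>pnats x. mangoldt n * ln (x / real n)) = psi x * ln x - (\<Sum>n\<in>pnats x. mangoldt n * ln (real n))"
      unfolding psi_def sum_distrib_right sum_subtractf[symmetric]
      by (rule sum.cong) (use x in \<open>auto simp: ln_div right_diff_distrib dest: pnatsD\<close>)
    have 2: "(\<Sum>n\<in>pnats x. mangoldt n * (psi (x / real n) - 1 * (x / real n))) =
        (\<Sum>n\<in>pnats x. mangoldt_conv n) - x * (\<Sum>n\<in>pnats x. mangoldt n / real n)"
      unfolding sum_mangoldt_psi[symmetric] by (simp add: right_diff_distrib sum_subtractf sum_distrib_left mult_ac)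
    show "\<bar>(\<Sum>n\<in>pnats x. selberg_weight n) - 2 * x * ln x\<bar> \<le>
      \<bar>((psi x - 1 * x) * ln x + (\<Sum>n\<in>pnats x. mangoldt n * (psi (x / real n) - 1 * (x / real n))))
      - (\<Sum>n\<in>pnats x. mangoldt n * ln (x / real n)) + (x * (\<Sum>n\<in>pnats x. mangoldt n / real n) - x * ln x)\<bar>"
      unfolding 1 2 by (simp add: selberg_weight_def sum.distrib algebra_simps)
  qed
qed

text \<open>For large \<open>x\<close> the term \<open>K * x\<close> is absorbed into
  \<open>\<epsilon>/2 * (x * ln x)\<close> and \<open>ln x\<close> is divided out. For the remaining
  \<open>x\<close> the second hypothesis gives a constant bound.\<close>

lemma sublin_of_sublog_times_ln:
  assumes "sublog (\<lambda>x. u x * ln x)" and L: "\<And>x. x \<ge> 1 \<Longrightarrow> \<bar>u x\<bar> \<le> L * x"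
  shows "sublin u"
  unfolding sublin_def
proof (intro allI impI)
  fix \<epsilon> :: real assume e: "\<epsilon> > 0"
  obtain K where K: "K \<ge> 0" "\<And>x. x \<ge> 1 \<Longrightarrow> \<bar>u x * ln x\<bar> \<le> \<epsilon>/2 * (x * ln x) + K * x"
    using sublogE[OF assms(1), of "\<epsilon>/2"] e by auto
  \<comment> \<open>Beyond \<open>X\<close> one has \<open>K \<le> \<epsilon>/2 * ln x\<close>; the
    summand 1 keeps \<open>ln x\<close> positive even for \<open>K = 0\<close>.\<close>
  define X where "X = exp (2 * K / \<epsilon> + 1)"
  have L0: "L \<ge> 0" using L[of 1] by simp
  show "\<exists>K. \<forall>x\<ge>1. \<bar>u x\<bar> \<le> \<epsilon> * x + K"
  proof (intro exI allI impI)
    fix x :: real assume x: "x \<ge> 1"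
    show "\<bar>u x\<bar> \<le> \<epsilon> * x + L * X"
    proof (cases "x \<ge> X")
      case True
      then have l: "ln x \<ge> 2 * K / \<epsilon> + 1" using x unfolding X_def by (simp add: ln_ge_iff)
      moreover have "2 * K / \<epsilon> \<ge> 0" using e K(1) by simp
      ultimately have l0: "ln x > 0" by linarith
      have "2 * K / \<epsilon> \<le> ln x" using l by simp
      then have "K \<le> \<epsilon>/2 * ln x" using e by (simp add: field_simps)
      then have "K * x \<le> \<epsilon>/2 * ln x * x" using x by (intro mult_right_mono) auto
      moreover have "\<bar>u x\<bar> * ln x = \<bar>u x * ln x\<bar>" using l0 by (simp add: abs_mult)
      moreover have "\<epsilon>/2 * (x * ln x) + \<epsilon>/2 * ln x * x = \<epsilon> * x * ln x" by simp
      ultimately have "\<bar>u x\<bar> * ln x \<le> \<epsilon> * x * ln x" using K(2)[OF x] by linarith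
      then have "\<bar>u x\<bar> \<le> \<epsilon> * x" using l0 by simp
      moreover have "L * X \<ge> 0" using L0 by (simp add: X_def)
      ultimately show ?thesis by linarith
    next
      case False
      then have "L * x \<le> L * X" using L0 by (intro mult_left_mono) auto
      moreover have "\<epsilon> * x \<ge> 0" using e x by simp
      ultimately show ?thesis using L[OF x] by linarith
    qed
  qed
qed

text \<open>
  Here and below the term \<open>n = 1\<close> of \<open>selberg_weight n / ln n\<close> is \<open>0 / 0 = 0\<close>.
\<close>

lemma selberg_weight_over_ln_linear_bound:
  obtains K where "\<And>x. x \<ge> 1 \<Longrightarrow> (\<Sum>n\<in>pnats x. selberg_weight n / ln (real n)) \<le> K * x"
proof -
  define W where "W x = (\<Sum>n\<in>pnats x. selberg_weight n)" for x
  obtain K where K: "K \<ge> 0" "\<And>x. x \<ge> 1 \<Longrightarrow> \<bar>W x - 2 * x * ln x\<bar> \<le> 1 * (x * ln x) + K * x"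
    using sublogE[OF selberg_formula, of 1] unfolding W_def by auto
  have W: "W x \<le> 3 * x * ln x + K * x" if "x \<ge> 1" for x
    using K(2)[OF that] by (simp add: abs_le_iff)
  define M where "M = 6 + 2 * K / ln 2 + (3 + K) / ln 2"
  have M0: "M \<ge> 0" using K by (simp add: M_def)
  show ?thesis
  proof (rule that)
    fix x :: real assume x: "x \<ge> 1"
    show "(\<Sum>n\<in>pnats x. selberg_weight n / ln (real n)) \<le> M * x"
    proof (cases "x < 2")
      case True
      then have "pnats x \<subseteq> {1}" by (auto simp: pnats_def)
      then have "(\<Sum>n\<in>pnats x. selberg_weight n / ln (real n)) = 0" by (intro sum.neutral) auto
      then show ?thesis using M0 x by simp
    next
      case False
      then have x2: "x \<ge> 2" by simp
      then have lx: "ln x \<ge> ln 2" "ln x > 0" "ln (2::real) > 0" by auto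
      have sub: "pnats (sqrt x) \<subseteq> pnats x"
        using x by (intro pnats_mono) (simp add: real_sqrt_le_iff' sqrt_le_D real_le_lsqrt power2_eq_square)
      \<comment> \<open>The sum is cut at \<open>sqrt x\<close>. Above the cut
        \<open>1 / ln n \<le> 2 / ln x\<close>. Below it the crude bound \<open>1 / ln 2\<close>
        suffices, because \<open>W (sqrt x)\<close> is of order at most
        \<open>sqrt x * ln (sqrt x)\<close>, hence at most linear in \<open>x\<close>.\<close>
      have "(\<Sum>n\<in>pnats x. selberg_weight n / ln (real n)) \<le>
         (\<Sum>n\<in>pnats x. 2 / ln x * selberg_weight n + (if n \<in> pnats (sqrt x) then selberg_weight n / ln 2 else 0))"
      proof (rule sum_mono)
        fix n assume n: "n \<in> pnats x"
        note n' = pnatsD[OF n]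
        have w: "selberg_weight n \<ge> 0" by (rule selberg_weight_nonneg)
        have w2: "2 / ln x * selberg_weight n \<ge> 0" using w lx(2) by (intro mult_nonneg_nonneg divide_nonneg_pos) auto
        show "selberg_weight n / ln (real n) \<le>
            2 / ln x * selberg_weight n + (if n \<in> pnats (sqrt x) then selberg_weight n / ln 2 else 0)"
        proof (cases "n = 1")
          case True then show ?thesis using w w2 lx by (simp add: selberg_weight_1)
        next
          case n1: False
          then have n2: "real n \<ge> 2" using n' by linarith
          then have ln2: "ln (real n) \<ge> ln 2" by simp
          show ?thesis
          proof (cases "n \<in> pnats (sqrt x)")
            case True
            have "selberg_weight n / ln (real n) \<le> selberg_weight n / ln 2"
              using w lx(3) ln2 by (intro divide_left_mono mult_pos_pos) linarith+
            then show ?thesis using True w2 by simp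
          next
            case False
            then have "sqrt x < real n" using n' by (auto simp: pnats_def)
            then have "ln (sqrt x) \<le> ln (real n)" using x n' by (subst ln_le_cancel_iff) auto
            then have "ln x / 2 \<le> ln (real n)" using x by (simp add: ln_sqrt)
            then have "selberg_weight n / ln (real n) \<le> selberg_weight n / (ln x / 2)"
              using w lx(2) by (intro divide_left_mono mult_pos_pos) linarith+
            then show ?thesis using False by (simp add: mult_ac)
          qed
        qed
      qed
      also have "\<dots> = 2 / ln x * W x + W (sqrt x) / ln 2"
        using sub by (simp add: W_def sum.distrib sum_distrib_left sum_divide_distrib sum.inter_restrict[symmetric] Int_absorb1 Int_absorb2)
      also have "2 / ln x * W x \<le> 2 / ln x * (3 * x * ln x + K * x)"
        using W[OF x] x by (intro mult_left_mono) auto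
      also have "\<dots> = 6 * x + 2 * K * x / ln x" using x2 by (simp add: field_simps)
      also have "2 * K * x / ln x \<le> 2 * K * x / ln 2"
        using lx(1) K x x2 by (intro divide_left_mono) auto
      also have "W (sqrt x) / ln 2 \<le> (3 + K) * x / ln 2"
      proof (rule divide_right_mono)
        have s: "sqrt x \<ge> 1" "sqrt x \<le> x" using x by (auto simp: real_le_lsqrt power2_eq_square)
        have "W (sqrt x) \<le> 3 * sqrt x * ln (sqrt x) + K * sqrt x" using W[OF s(1)] .
        also have "\<dots> \<le> 3 * sqrt x * sqrt x + K * x"
          using s K ln_le_minus_one[of "sqrt x"] x by (intro add_mono mult_left_mono) auto
        also have "\<dots> = (3 + K) * x" using x by (simp add: algebra_simps)
        finally show "W (sqrt x) \<le> (3 + K) * x" .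
      qed (use lx in simp)
      finally show ?thesis by (simp add: M_def algebra_simps)
    qed
  qed
qed

text \<open>Writing \<open>ln x = ln n + ln (x / n)\<close> turns \<open>ln x\<close> times the sum
  into the sum in Selberg's formula plus a sum weighted by \<open>ln (x / n)\<close>. The latter is
  \<open>sublog\<close> by the linear bound just proved, and \<open>ln x\<close> is then divided
  out.\<close>

lemma sublin_selberg_weight_over_ln:
  "sublin (\<lambda>x. (\<Sum>n\<in>pnats x. selberg_weight n / ln (real n)) - 2 * x)"
proof -
  define V where "V x = (\<Sum>n\<in>pnats x. selberg_weight n / ln (real n))" for x
  obtain K where K: "\<And>x. x \<ge> 1 \<Longrightarrow> V x \<le> K * x"
    using selberg_weight_over_ln_linear_bound unfolding V_def by blast
  have v0: "selberg_weight n / ln (real n) \<ge> 0" for n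
    using selberg_weight_nonneg[of n] by (cases "n = 0") auto
  have "sublin (\<lambda>x. V x - 2 * x)"
  proof (rule sublin_of_sublog_times_ln)
    fix x :: real assume x: "x \<ge> 1"
    have "V x \<ge> 0" unfolding V_def by (intro sum_nonneg v0)
    then show "\<bar>V x - 2 * x\<bar> \<le> (K + 2) * x" using K[OF x] x unfolding distrib_right by linarith
  next
    have "sublog (\<lambda>x. ((\<Sum>n\<in>pnats x. selberg_weight n) - 2 * x * ln x) +
        (\<Sum>n\<in>pnats x. selberg_weight n / ln (real n) * ln (x / real n)))"
      using K by (intro sublog_add selberg_formula sublog_sum_ln_quotient[where K=K, OF v0]) (simp add: V_def)
    then show "sublog (\<lambda>x. (V x - 2 * x) * ln x)"
    proof (rule sublog_mono)
      fix x :: real assume x: "x \<ge> 1"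
      have "(\<Sum>n\<in>pnats x. selberg_weight n / ln (real n) * ln (x / real n)) = V x * ln x - (\<Sum>n\<in>pnats x. selberg_weight n)"
        unfolding V_def sum_distrib_right sum_subtractf[symmetric]
      proof (rule sum.cong[OF refl])
        fix n assume n: "n \<in> pnats x"
        show "selberg_weight n / ln (real n) * ln (x / real n) =
          selberg_weight n / ln (real n) * ln x - selberg_weight n"
          using pnatsD[OF n] x by (cases "n = 1") (auto simp: ln_div selberg_weight_1 field_simps)
      qed
      then show "\<bar>(V x - 2 * x) * ln x\<bar> \<le> \<bar>((\<Sum>n\<in>pnats x. selberg_weight n) - 2 * x * ln x) +
        (\<Sum>n\<in>pnats x. selberg_weight n / ln (real n) * ln (x / real n))\<bar>"
        by (simp add: left_diff_distrib)
    qed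
  qed
  then show ?thesis by (simp add: V_def)
qed

subsection \<open>Replacing the Selberg weights by their mean\<close>

lemma abel_summation:
  fixes T \<phi> :: "nat \<Rightarrow> real"
  assumes "T 0 = 0"
  shows "(\<Sum>n=1..N. (T n - T (n - 1)) * \<phi> n) = (\<Sum>n=1..<N. T n * (\<phi> n - \<phi> (Suc n))) + T N * \<phi> N"
proof (induction N)
  case (Suc N)
  show ?case
  proof (cases "N = 0")
    case False
    then have "{1..<Suc N} = insert N {1..<N}" by auto
    then show ?thesis using Suc by (simp add: algebra_simps)
  qed (simp add: assms)
qed (simp add: assms)

text \<open>Summation by parts is used twice: first to expose the differences of
  \<open>\<phi>\<close>, which are replaced by those of \<open>\<Phi>\<close>, then backwards with
  the bound for \<open>T\<close> in place of \<open>T\<close>.\<close>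

lemma abel_summation_bound:
  fixes T \<phi> \<Phi> :: "nat \<Rightarrow> real"
  assumes T0: "T 0 = 0" and T: "\<And>n. 1 \<le> n \<Longrightarrow> \<bar>T n\<bar> \<le> \<epsilon> * real n + K" and N: "1 \<le> N"
    and \<phi>: "\<And>n. 1 \<le> n \<Longrightarrow> n < N \<Longrightarrow> \<bar>\<phi> n - \<phi> (Suc n)\<bar> \<le> \<Phi> n - \<Phi> (Suc n)"
    and \<phi>N: "\<bar>\<phi> N\<bar> \<le> \<Phi> N"
  shows "\<bar>\<Sum>n=1..N. (T n - T (n - 1)) * \<phi> n\<bar> \<le> \<epsilon> * (\<Sum>n=1..N. \<Phi> n) + K * \<Phi> 1"
proof -
  \<comment> \<open>Summing back needs \<open>S 0 = 0\<close>. The increments of \<open>S\<close>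
    are then \<open>\<epsilon>\<close>, except for the first one, \<open>\<epsilon> + K\<close>,
    which yields the term \<open>K * \<Phi> 1\<close>.\<close>
  define S where "S n = (if n = 0 then 0 else \<epsilon> * real n + K)" for n
  have S: "\<bar>T n\<bar> \<le> S n" if "1 \<le> n" for n using T[OF that] that by (simp add: S_def)
  have "\<bar>\<Sum>n=1..N. (T n - T (n - 1)) * \<phi> n\<bar> = \<bar>(\<Sum>n=1..<N. T n * (\<phi> n - \<phi> (Suc n))) + T N * \<phi> N\<bar>"
    by (simp only: abel_summation[of T, OF T0])
  also have "\<dots> \<le> (\<Sum>n=1..<N. \<bar>T n * (\<phi> n - \<phi> (Suc n))\<bar>) + \<bar>T N * \<phi> N\<bar>"
    by (intro order_trans[OF abs_triangle_ineq] add_mono sum_abs) simp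
  also have "\<dots> \<le> (\<Sum>n=1..<N. S n * (\<Phi> n - \<Phi> (Suc n))) + S N * \<Phi> N"
    unfolding abs_mult
  proof (intro add_mono sum_mono mult_mono)
    fix n assume "n \<in> {1..<N}"
    then show "\<bar>T n\<bar> \<le> S n" "\<bar>\<phi> n - \<phi> (Suc n)\<bar> \<le> \<Phi> n - \<Phi> (Suc n)" "0 \<le> S n"
      using S[of n] \<phi>[of n] by auto
  qed (use S[OF N] \<phi>N in auto)
  also have "\<dots> = (\<Sum>n=1..N. (S n - S (n - 1)) * \<Phi> n)"
    by (rule abel_summation[symmetric]) (simp add: S_def)
  also have "\<dots> = (\<Sum>n=1..N. \<epsilon> * \<Phi> n + (if n = 1 then K * \<Phi> n else 0))"
    by (rule sum.cong) (auto simp: S_def algebra_simps of_nat_diff)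
  also have "\<dots> = \<epsilon> * (\<Sum>n=1..N. \<Phi> n) + K * \<Phi> 1"
    using N by (simp add: sum.distrib sum_distrib_left)
  finally show ?thesis .
qed

lemma integral_inverse_square:
  assumes "0 < a" "a \<le> (b::real)"
  shows "((\<lambda>t. c / t\<^sup>2) has_integral c * (1 / a - 1 / b)) {a..b}"
proof -
  have "((\<lambda>t. c / t\<^sup>2) has_integral (- c / b) - (- c / a)) {a..b}"
  proof (rule fundamental_theorem_of_calculus[OF assms(2)])
    fix t assume "t \<in> {a..b}"
    then have "((\<lambda>t. - c / t) has_real_derivative c / t\<^sup>2) (at t within {a..b})"
      using assms by (auto intro!: derivative_eq_intros simp: power2_eq_square)
    then show "((\<lambda>t. - c / t) has_vector_derivative c / t\<^sup>2) (at t within {a..b})"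
      by (simp add: has_real_derivative_iff_has_vector_derivative)
  qed
  then show ?thesis by (simp add: algebra_simps)
qed

context selberg_function
begin

text \<open>A non-decreasing function on \<open>[1, \<infinity>)\<close> that dominates both the
  size of \<open>rem\<close> and, through its increments, the variation of \<open>rem\<close>. The
  function \<open>rem\<close> itself need not be monotone.\<close>

definition majorant :: "real \<Rightarrow> real" where
  "majorant y = f y + \<bar>A\<bar> * y"

lemma majorant_mono: "1 \<le> u \<Longrightarrow> u \<le> v \<Longrightarrow> majorant u \<le> majorant v"
  unfolding majorant_def by (intro add_mono mult_left_mono mono_onD[OF mono]) auto

lemma rem_le_majorant: "y \<ge> 1 \<Longrightarrow> \<bar>rem y\<bar> \<le> majorant y"
  using nonneg[of y] abs_mult[of A y] by (simp add: majorant_def abs_le_iff) (smt (verit) abs_ge_self)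

lemma rem_variation_le:
  assumes "1 \<le> u" "u \<le> v"
  shows "\<bar>rem v - rem u\<bar> \<le> majorant v - majorant u"
proof -
  have "f u \<le> f v" using assms by (intro mono_onD[OF mono]) auto
  moreover have "\<bar>A * v - A * u\<bar> = \<bar>A\<bar> * v - \<bar>A\<bar> * u"
    using assms by (simp add: right_diff_distrib[symmetric] abs_mult)
  ultimately show ?thesis unfolding majorant_def by linarith
qed

lemma majorant_linear_bound:
  obtains K where "K \<ge> 0" "\<And>x. x \<ge> 1 \<Longrightarrow> \<bar>majorant x\<bar> \<le> K * x"
proof -
  obtain K where K: "K \<ge> 0" "\<And>x. x \<ge> 1 \<Longrightarrow> f x \<le> K * x" using linear_bound by blast
  have "\<bar>majorant x\<bar> \<le> (K + \<bar>A\<bar>) * x" if "x \<ge> 1" for x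
    using K(2)[OF that] nonneg[OF that] that by (simp add: majorant_def distrib_right)
  with K(1) show ?thesis by (intro that[of "K + \<bar>A\<bar>"]) auto
qed

lemma sum_majorant_bound:
  obtains K where "\<And>x. x \<ge> 1 \<Longrightarrow> (\<Sum>n\<in>pnats x. majorant (x / real n)) \<le> 2 * \<bar>A\<bar> * (x * ln x) + K * x"
proof -
  obtain K where K: "\<And>x. x \<ge> 1 \<Longrightarrow> \<bar>dilate_sum f x - A * x * ln x\<bar> \<le> K * x" using dilate_sum_bound by blast
  show ?thesis
  proof (rule that)
    fix x :: real assume x: "x \<ge> 1"
    have "(\<Sum>n\<in>pnats x. majorant (x / real n)) = dilate_sum f x + \<bar>A\<bar> * x * (\<Sum>n\<in>pnats x. 1 / real n)"
      by (simp add: majorant_def dilate_sum_pnats sum.distrib sum_distrib_left)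
    also have "\<dots> \<le> (A * x * ln x + K * x) + \<bar>A\<bar> * x * (ln x + (euler_mascheroni + 2))"
      using K[OF x] harmonic_sum_le(1)[OF x] x by (intro add_mono mult_left_mono) (auto simp: abs_le_iff)
    also have "A * x * ln x \<le> \<bar>A\<bar> * x * ln x" using x by (intro mult_right_mono) auto
    finally show "(\<Sum>n\<in>pnats x. majorant (x / real n)) \<le> 2 * \<bar>A\<bar> * (x * ln x) + (K + \<bar>A\<bar> * (euler_mascheroni + 2)) * x"
      by (simp add: algebra_simps)
  qed
qed

text \<open>The partial sums of \<open>selberg_weight n / ln n - 2\<close> are \<open>o(n)\<close>.
  Summation by parts moves the variation onto \<open>majorant\<close>, whose sum over the dilates
  has order at most \<open>x * ln x\<close>. The function \<open>\<phi>\<close> is left general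
  because both \<open>rem\<close> and its absolute value are needed.\<close>

lemma sublog_weighted_minus_mean:
  assumes var: "\<And>u v. 1 \<le> u \<Longrightarrow> u \<le> v \<Longrightarrow> \<bar>\<phi> v - \<phi> u\<bar> \<le> majorant v - majorant u"
    and bound: "\<And>y. y \<ge> 1 \<Longrightarrow> \<bar>\<phi> y\<bar> \<le> majorant y"
  shows "sublog (\<lambda>x. \<Sum>n\<in>pnats x. (selberg_weight n / ln (real n) - 2) * \<phi> (x / real n))"
  unfolding sublog_def
proof (intro allI impI)
  fix \<epsilon> :: real assume e: "\<epsilon> > 0"
  define \<delta> where "\<delta> = \<epsilon> / (2 * \<bar>A\<bar> + 1)"
  have d: "\<delta> > 0" using e by (simp add: \<delta>_def add_nonneg_pos)
  have Ad: "\<delta> * (2 * \<bar>A\<bar>) \<le> \<epsilon>" using e by (simp add: \<delta>_def field_simps)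
  define T where "T n = (\<Sum>k=1..n. selberg_weight k / ln (real k) - 2)" for n
  obtain K where K: "K \<ge> 0"
    "\<And>x. x \<ge> 1 \<Longrightarrow> \<bar>(\<Sum>n\<in>pnats x. selberg_weight n / ln (real n)) - 2 * x\<bar> \<le> \<delta> * x + K"
    using sublinE[OF sublin_selberg_weight_over_ln d] by auto
  obtain M where M: "\<And>x. x \<ge> 1 \<Longrightarrow> (\<Sum>n\<in>pnats x. majorant (x / real n)) \<le> 2 * \<bar>A\<bar> * (x * ln x) + M * x"
    using sum_majorant_bound by blast
  obtain L where L: "\<And>x. x \<ge> 1 \<Longrightarrow> \<bar>majorant x\<bar> \<le> L * x" using majorant_linear_bound by blast
  have T: "\<bar>T n\<bar> \<le> \<delta> * real n + K" if "1 \<le> n" for n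
    using K(2)[of "real n"] that by (simp add: T_def pnats_eq sum_subtractf mult_ac)
  show "\<exists>K. \<forall>x\<ge>1. \<bar>\<Sum>n\<in>pnats x. (selberg_weight n / ln (real n) - 2) * \<phi> (x / real n)\<bar> \<le> \<epsilon> * (x * ln x) + K * x"
  proof (intro exI allI impI)
    fix x :: real assume x: "x \<ge> 1"
    define N where "N = nat \<lfloor>x\<rfloor>"
    have N: "1 \<le> N" "real N \<le> x" using x unfolding N_def by linarith+
    have pn: "pnats x = {1..N}" by (simp add: pnats_eq N_def)
    have "(\<Sum>n\<in>pnats x. (selberg_weight n / ln (real n) - 2) * \<phi> (x / real n)) =
          (\<Sum>n=1..N. (T n - T (n - 1)) * \<phi> (x / real n))"
      unfolding pn
    proof (rule sum.cong[OF refl])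
      fix n assume "n \<in> {1..N}"
      then obtain m where "n = Suc m" by (cases n) auto
      then have "T n - T (n - 1) = selberg_weight n / ln (real n) - 2" by (simp add: T_def)
      then show "(selberg_weight n / ln (real n) - 2) * \<phi> (x / real n) = (T n - T (n - 1)) * \<phi> (x / real n)" by simp
    qed
    also have "\<bar>\<dots>\<bar> \<le> \<delta> * (\<Sum>n=1..N. majorant (x / real n)) + K * majorant (x / real 1)"
    proof (rule abel_summation_bound)
      fix n assume n: "1 \<le> n" "n < N"
      then have "1 \<le> x / real (Suc n)" "x / real (Suc n) \<le> x / real n"
        using N x by (auto simp: field_simps)
      then show "\<bar>\<phi> (x / real n) - \<phi> (x / real (Suc n))\<bar> \<le> majorant (x / real n) - majorant (x / real (Suc n))"
        by (rule var)
    next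
      show "\<bar>\<phi> (x / real N)\<bar> \<le> majorant (x / real N)" using N by (intro bound) (auto simp: field_simps)
    qed (use T N in \<open>auto simp: T_def\<close>)
    also have "\<dots> \<le> \<delta> * (2 * \<bar>A\<bar> * (x * ln x) + M * x) + K * (L * x)"
      using M[OF x] L[OF x] d K(1) unfolding pn by (intro add_mono mult_left_mono) auto
    also have "\<dots> = \<delta> * (2 * \<bar>A\<bar>) * (x * ln x) + (\<delta> * M + K * L) * x" by (simp add: algebra_simps)
    also have "\<delta> * (2 * \<bar>A\<bar>) * (x * ln x) \<le> \<epsilon> * (x * ln x)" using Ad x by (intro mult_right_mono) auto
    finally show "\<bar>\<Sum>n\<in>pnats x. (selberg_weight n / ln (real n) - 2) * \<phi> (x / real n)\<bar> \<le>
       \<epsilon> * (x * ln x) + (\<delta> * M + K * L) * x" by simp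
  qed
qed

text \<open>Two expressions for \<open>rem x * ln x\<close> are combined, one with weights
  \<open>mangoldt\<close> and one with weights \<open>v2\<close>. Their sum \<open>v\<close> has
  mean 2, so adding the two triangle inequalities gives twice the claim.\<close>

lemma rem_ln_le_dilate_sum:
  obtains D where "sublog D" "\<And>x. x \<ge> 1 \<Longrightarrow> \<bar>rem x\<bar> * ln x \<le> dilate_sum (\<lambda>t. \<bar>rem t\<bar>) x + D x"
proof -
  define v where "v n = selberg_weight n / ln (real n)" for n
  define v2 where "v2 n = mangoldt_conv n / ln (real n)" for n
  have v2: "v2 n \<ge> 0" for n
    unfolding v2_def using mangoldt_conv_nonneg[of n] by (cases "n = 0") auto
  have v: "v n = mangoldt n + v2 n" if "n \<in> pnats x" for n x
    using pnatsD[OF that]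
    by (cases "n = 1") (auto simp: v_def v2_def selberg_weight_def mangoldt_conv_def add_divide_distrib)
  define E1 where "E1 x = rem x * ln x + (\<Sum>n\<in>pnats x. mangoldt n * rem (x / real n))" for x
  define X where "X x = (\<Sum>n\<in>pnats x. (v n - 2) * rem (x / real n))" for x
  define Y where "Y x = (\<Sum>n\<in>pnats x. (v n - 2) * \<bar>rem (x / real n)\<bar>)" for x
  \<comment> \<open>The bracket equals the sum of \<open>v n * rem (x / n)\<close>: \<open>X\<close>
    carries the weights \<open>v n - 2\<close>, and the two dilate sums restore the 2. Subtracting
    it from \<open>E1\<close> exchanges the weights \<open>mangoldt\<close> for
    \<open>- v2\<close>.\<close>
  define E2 where "E2 x = E1 x - (X x + (dilate_sum rem x + dilate_sum rem x))" for x
  have E1: "sublog E1"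
    unfolding E1_def using selberg_formula_general[OF dilate_sum_rem_sublin] .
  have X: "sublog X"
    unfolding X_def v_def by (rule sublog_weighted_minus_mean[where \<phi>=rem, OF rem_variation_le rem_le_majorant])
  have Y: "sublog Y"
    unfolding Y_def v_def
  proof (rule sublog_weighted_minus_mean[where \<phi>="\<lambda>t. \<bar>rem t\<bar>"])
    fix u v :: real assume "1 \<le> u" "u \<le> v"
    then show "\<bar>\<bar>rem v\<bar> - \<bar>rem u\<bar>\<bar> \<le> majorant v - majorant u"
      using rem_variation_le[of u v] by linarith
  qed (use rem_le_majorant in simp)
  obtain K where "\<And>x. x \<ge> 1 \<Longrightarrow> \<bar>dilate_sum rem x\<bar> \<le> K * x" using dilate_sum_rem_bound by blast
  then have G: "sublog (dilate_sum rem)" by (rule sublog_linear_bound)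
  have E2: "sublog E2"
    unfolding E2_def by (rule sublog_diff[OF E1 sublog_add[OF X sublog_add[OF G G]]])
  have alg: "(p - 2) * r + (r + r) = p * r" for p r :: real by (simp add: algebra_simps)
  have E2_eq: "E2 x = rem x * ln x - (\<Sum>n\<in>pnats x. v2 n * rem (x / real n))" for x
  proof -
    have "X x + (dilate_sum rem x + dilate_sum rem x) = (\<Sum>n\<in>pnats x. v n * rem (x / real n))"
      unfolding X_def dilate_sum_pnats sum.distrib[symmetric] by (rule sum.cong) (simp_all only: alg)
    also have "\<dots> = (\<Sum>n\<in>pnats x. mangoldt n * rem (x / real n)) + (\<Sum>n\<in>pnats x. v2 n * rem (x / real n))"
      unfolding sum.distrib[symmetric] by (rule sum.cong) (auto simp: v distrib_right)
    finally show ?thesis by (simp add: E2_def E1_def)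
  qed
  define D where "D x = (\<bar>E1 x\<bar> + \<bar>E2 x\<bar> + Y x) / 2" for x
  have "sublog (\<lambda>x. \<bar>E1 x\<bar> + \<bar>E2 x\<bar> + \<bar>Y x\<bar>)"
    by (intro sublog_add sublog_mono[OF E1] sublog_mono[OF E2] sublog_mono[OF Y]) auto
  then have "sublog D"
  proof (rule sublog_mono)
    fix x
    have "\<bar>(a + b + y) / 2\<bar> \<le> \<bar>a + b + \<bar>y\<bar>\<bar>" if "0 \<le> a" "0 \<le> b" for a b y :: real
      using that by (cases "0 \<le> y") (auto simp: abs_le_iff)
    then show "\<bar>D x\<bar> \<le> \<bar>\<bar>E1 x\<bar> + \<bar>E2 x\<bar> + \<bar>Y x\<bar>\<bar>" by (simp only: D_def abs_ge_zero)
  qed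
  moreover have "\<bar>rem x\<bar> * ln x \<le> dilate_sum (\<lambda>t. \<bar>rem t\<bar>) x + D x" if x: "x \<ge> 1" for x
  proof -
    have eq: "\<bar>rem x\<bar> * ln x = \<bar>rem x * ln x\<bar>" using x by (simp add: abs_mult)
    have "\<bar>\<Sum>n\<in>pnats x. mangoldt n * rem (x / real n)\<bar> \<le> (\<Sum>n\<in>pnats x. mangoldt n * \<bar>rem (x / real n)\<bar>)"
      by (rule order_trans[OF sum_abs]) (simp add: abs_mult)
    moreover have "\<bar>\<Sum>n\<in>pnats x. v2 n * rem (x / real n)\<bar> \<le> (\<Sum>n\<in>pnats x. v2 n * \<bar>rem (x / real n)\<bar>)"
      by (rule order_trans[OF sum_abs]) (simp add: abs_mult v2)
    moreover have "(\<Sum>n\<in>pnats x. mangoldt n * \<bar>rem (x / real n)\<bar>) + (\<Sum>n\<in>pnats x. v2 n * \<bar>rem (x / real n)\<bar>) =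
        Y x + 2 * dilate_sum (\<lambda>t. \<bar>rem t\<bar>) x"
      unfolding Y_def dilate_sum_pnats sum.distrib[symmetric] sum_distrib_left
      by (rule sum.cong) (simp_all add: v left_diff_distrib distrib_right)
    ultimately have "2 * \<bar>rem x * ln x\<bar> \<le> \<bar>E1 x\<bar> + \<bar>E2 x\<bar> + Y x + 2 * dilate_sum (\<lambda>t. \<bar>rem t\<bar>) x"
      using E2_eq[of x] E1_def[of x] by linarith
    moreover have "p \<le> r + q / 2" if "2 * p \<le> q + 2 * r" for p q r :: real using that by simp
    ultimately show ?thesis unfolding eq D_def by blast
  qed
  ultimately show ?thesis using that by blast
qed

section \<open>Comparison of the dilate sum with the integral\<close>

lemma rem_over_square_integrable:
  assumes "1 \<le> a"
  shows "(\<lambda>t. \<bar>rem t\<bar> / t\<^sup>2) integrable_on {a..b}"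
proof (rule measurable_bounded_by_integrable_imp_integrable_real)
  \<comment> \<open>Monotonicity is what makes \<open>f\<close> measurable here; boundedness of the
    integrand follows from \<open>majorant\<close> and \<open>t \<ge> 1\<close>.\<close>
  have "mono_on {a..b} f" using mono assms by (auto simp: mono_on_def)
  then have [measurable]: "f \<in> borel_measurable (lebesgue_on {a..b})"
    by (intro borel_measurable_integrable integrable_mono_on)
  have [measurable]: "(\<lambda>t::real. t) \<in> borel_measurable (lebesgue_on {a..b})"
    by (intro measurable_restrict_space1 measurable_completion) simp
  show "(\<lambda>t. \<bar>rem t\<bar> / t\<^sup>2) \<in> borel_measurable (lebesgue_on {a..b})"
    by measurable
  show "(\<lambda>_. majorant b) integrable_on {a..b}" by (rule integrable_const_ivl)
  fix t assume t: "t \<in> {a..b}"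
  then have "\<bar>rem t\<bar> \<le> majorant b" using assms rem_le_majorant[of t] majorant_mono[of t b] by auto
  moreover have "\<bar>rem t\<bar> / t\<^sup>2 \<le> \<bar>rem t\<bar> / 1" using t assms by (intro divide_left_mono) auto
  ultimately show "\<bar>\<bar>rem t\<bar> / t\<^sup>2\<bar> \<le> majorant b" by simp
qed simp

text \<open>The term at \<open>n\<close> is compared with the integral over
  \<open>[x / (n + 1), x / n]\<close>, where \<open>x / t\<^sup>2\<close> has total mass 1. The loss
  on each interval is at most the increment of \<open>majorant\<close>, and these increments
  telescope.\<close>

lemma dilate_sum_le_integral:
  assumes x: "x \<ge> 1"
  shows "dilate_sum (\<lambda>t. \<bar>rem t\<bar>) x \<le> x * integral {1..x} (\<lambda>t. \<bar>rem t\<bar> / t\<^sup>2) + majorant x"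
proof -
  define I where "I a b = integral {a..b} (\<lambda>t. \<bar>rem t\<bar> / t\<^sup>2)" for a b
  define N where "N = nat \<lfloor>x\<rfloor>"
  have N: "1 \<le> N" "real N \<le> x" using x unfolding N_def by linarith+
  have pn: "pnats x = {1..N}" by (simp add: pnats_eq N_def)
  have comb: "I a b + I b c = I a c" if "1 \<le> a" "a \<le> b" "b \<le> c" for a b c
    unfolding I_def using that rem_over_square_integrable[of a c]
    by (intro Henstock_Kurzweil_Integration.integral_combine) auto
  have "m \<le> N \<longrightarrow> (\<Sum>n=1..<m. \<bar>rem (x / real n)\<bar>) \<le> x * I (x / real m) x + majorant x - majorant (x / real m)"
    if "1 \<le> m" for m
    using that
  proof (induction m rule: dec_induct)
    case base then show ?case by (simp add: I_def)
  next
    case (step m)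
    show ?case
    proof
      assume m: "Suc m \<le> N"
      let ?a = "x / real (Suc m)" and ?b = "x / real m"
      have ab: "1 \<le> ?a" "?a \<le> ?b" "?b \<le> x" using m N step x by (auto simp: field_simps mult_le_cancel_left1)
      \<comment> \<open>A lower bound for the absolute value of \<open>rem\<close> on the whole
        interval; it may be negative.\<close>
      define c where "c = \<bar>rem ?b\<bar> - (majorant ?b - majorant ?a)"
      have "c * (1 / ?a - 1 / ?b) \<le> I ?a ?b"
      proof -
        have "((\<lambda>t. c / t\<^sup>2) has_integral c * (1 / ?a - 1 / ?b)) {?a..?b}"
          using ab by (intro integral_inverse_square) linarith+
        moreover have "((\<lambda>t. \<bar>rem t\<bar> / t\<^sup>2) has_integral I ?a ?b) {?a..?b}"
          unfolding I_def by (intro integrable_integral rem_over_square_integrable ab)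
        ultimately show ?thesis
        proof (rule has_integral_le)
          fix t assume t: "t \<in> {?a..?b}"
          then have "1 \<le> t" "t \<le> ?b" "?a \<le> t" using ab(1) unfolding atLeastAtMost_iff by linarith+
          then have "\<bar>rem ?b - rem t\<bar> \<le> majorant ?b - majorant t" "majorant ?a \<le> majorant t"
            using rem_variation_le majorant_mono ab(1) by blast+
          then have "c \<le> \<bar>rem t\<bar>" unfolding c_def by linarith
          then show "c / t\<^sup>2 \<le> \<bar>rem t\<bar> / t\<^sup>2" by (simp add: divide_right_mono)
        qed
      qed
      then have "x * (c * (1 / ?a - 1 / ?b)) \<le> x * I ?a ?b" using x by (intro mult_left_mono) auto
      \<comment> \<open>The factor \<open>x * (1 / ?a - 1 / ?b)\<close> is
        \<open>(m + 1) - m = 1\<close>.\<close>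
      also have "x * (c * (1 / ?a - 1 / ?b)) = c" using x step by (simp add: field_simps)
      finally have "\<bar>rem ?b\<bar> \<le> x * I ?a ?b + majorant ?b - majorant ?a" unfolding c_def by linarith
      moreover have "(\<Sum>n=1..<Suc m. \<bar>rem (x / real n)\<bar>) = (\<Sum>n=1..<m. \<bar>rem (x / real n)\<bar>) + \<bar>rem ?b\<bar>"
        using step by simp
      moreover have "(\<Sum>n=1..<m. \<bar>rem (x / real n)\<bar>) \<le> x * I ?b x + majorant x - majorant ?b"
        using step m by simp
      moreover have "x * I ?a x = x * I ?a ?b + x * I ?b x"
        using comb[OF ab] by (simp add: distrib_left[symmetric])
      ultimately show "(\<Sum>n=1..<Suc m. \<bar>rem (x / real n)\<bar>) \<le> x * I ?a x + majorant x - majorant ?a" by linarith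
    qed
  qed
  from this[OF N(1)] have "(\<Sum>n=1..<N. \<bar>rem (x / real n)\<bar>) \<le> x * I (x / real N) x + majorant x - majorant (x / real N)"
    by simp
  moreover have xN: "1 \<le> x / real N" "x / real N \<le> x" using N x by (auto simp: field_simps mult_le_cancel_left1)
  moreover have "\<bar>rem (x / real N)\<bar> \<le> majorant (x / real N)" by (rule rem_le_majorant[OF xN(1)])
  moreover have "{1..N} = insert N {1..<N}" using N by auto
  then have "dilate_sum (\<lambda>t. \<bar>rem t\<bar>) x = (\<Sum>n=1..<N. \<bar>rem (x / real n)\<bar>) + \<bar>rem (x / real N)\<bar>"
    unfolding dilate_sum_pnats pn by simp
  moreover have "x * I (x / real N) x \<le> x * I 1 x"
  proof (rule mult_left_mono)
    have "I 1 (x / real N) \<ge> 0" unfolding I_def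
      by (intro integral_nonneg rem_over_square_integrable) auto
    then show "I (x / real N) x \<le> I 1 x" using comb[OF order.refl xN] by linarith
  qed (use x in simp)
  ultimately show ?thesis unfolding I_def[symmetric] by linarith
qed

end

section \<open>From the asymptotic hypothesis to the theorem\<close>

lemma sublin_of_asymp:
  assumes nonneg: "\<And>x. x \<ge> 1 \<Longrightarrow> f x \<ge> 0" and mono: "mono_on {1..} f"
    and asymp: "(\<lambda>x. dilate_sum f x - (A * x * ln x + B * x + C * (x / ln x))) \<in> o[at_top](\<lambda>x. x / ln x)"
  shows "sublin (\<lambda>y. ln y * dilate_sum f y - A * y * (ln y)\<^sup>2 - B * y * ln y - C * y)"
  unfolding sublin_def
proof (intro allI impI)
  fix \<epsilon> :: real assume e: "\<epsilon> > 0"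
  obtain Y0 where Y0: "\<And>x. x \<ge> Y0 \<Longrightarrow>
      norm (dilate_sum f x - (A * x * ln x + B * x + C * (x / ln x))) \<le> \<epsilon> * norm (x / ln x)"
    using landau_o.smallD[OF asymp e] unfolding eventually_at_top_linorder by blast
  define Y where "Y = max 2 Y0"
  \<comment> \<open>Below \<open>Y\<close> the asymptotics give no information; there each term is
    bounded by its value at \<open>Y\<close>, the dilate sum by monotonicity of
    \<open>f\<close>.\<close>
  define K where "K = ln Y * (Y * f Y) + \<bar>A\<bar> * Y * (ln Y)\<^sup>2 + \<bar>B\<bar> * Y * ln Y + \<bar>C\<bar> * Y"
  have Y: "Y \<ge> 2" "Y \<ge> Y0" by (auto simp: Y_def)
  have K0: "K \<ge> 0" using Y nonneg[of Y] by (auto simp: K_def intro!: add_nonneg_nonneg mult_nonneg_nonneg)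
  show "\<exists>K. \<forall>x\<ge>1. \<bar>ln x * dilate_sum f x - A * x * (ln x)\<^sup>2 - B * x * ln x - C * x\<bar> \<le> \<epsilon> * x + K"
  proof (intro exI allI impI)
    fix x :: real assume x: "x \<ge> 1"
    let ?r = "ln x * dilate_sum f x - A * x * (ln x)\<^sup>2 - B * x * ln x - C * x"
    show "\<bar>?r\<bar> \<le> \<epsilon> * x + K"
    proof (cases "x \<ge> Y")
      case True
      then have l: "ln x > 0" using Y by simp
      let ?d = "dilate_sum f x - (A * x * ln x + B * x + C * (x / ln x))"
      have "?r = ln x * ?d" using l by (simp add: field_simps power2_eq_square)
      also have "\<bar>\<dots>\<bar> = ln x * \<bar>?d\<bar>" using l by (simp add: abs_mult)
      also have "\<dots> \<le> ln x * (\<epsilon> * (x / ln x))"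
        using Y0[of x] True Y l x by (intro mult_left_mono) auto
      also have "\<dots> = \<epsilon> * x" using l by simp
      finally show ?thesis using K0 by linarith
    next
      case False
      then have xY: "x \<le> Y" by simp
      have l: "0 \<le> ln x" "ln x \<le> ln Y" using x xY by auto
      note F = dilate_sum_bounds[OF nonneg mono x xY]
      have "\<bar>ln x * dilate_sum f x\<bar> \<le> ln Y * (Y * f Y)"
        unfolding abs_mult using F l by (intro mult_mono) auto
      moreover have "\<bar>A * x * (ln x)\<^sup>2\<bar> \<le> \<bar>A\<bar> * Y * (ln Y)\<^sup>2"
        unfolding abs_mult using x xY l by (intro mult_mono) (auto intro: power_mono)
      moreover have "\<bar>B * x * ln x\<bar> \<le> \<bar>B\<bar> * Y * ln Y"
        unfolding abs_mult using x xY l by (intro mult_mono) auto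
      moreover have "\<bar>C * x\<bar> \<le> \<bar>C\<bar> * Y"
        unfolding abs_mult using x xY l by (intro mult_mono) auto
      moreover have "\<epsilon> * x \<ge> 0" using e x by simp
      ultimately show ?thesis unfolding K_def by linarith
    qed
  qed
qed

theorem theorem2p3:
  fixes f g :: "real \<Rightarrow> real" and A B C :: real
  assumes nonneg: "\<And>x. x \<ge> 1 \<Longrightarrow> f x \<ge> 0"
    and mono: "mono_on {1..} f"
    and asymp: "(\<lambda>x. dilate_sum f x - (A * x * ln x + B * x + C * (x / ln x)))
                  \<in> o[at_top](\<lambda>x. x / ln x)"
    and g: "\<And>x. x \<ge> 1 \<Longrightarrow> g x = f x - A * x"
  shows "\<exists>h :: real \<Rightarrow> real. (h \<longlongrightarrow> 0) at_top \<and>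
           (\<forall>x>1. \<bar>g x\<bar> / x \<le> 1 / ln x * integral {1..x} (\<lambda>t. \<bar>g t\<bar> / t\<^sup>2) + h x)"
proof -
  interpret selberg_function f A B C
    using nonneg mono sublin_of_asymp[OF nonneg mono asymp] by unfold_locales auto
  define I where "I x = integral {1..x} (\<lambda>t. \<bar>g t\<bar> / t\<^sup>2)" for x
  \<comment> \<open>As the positive part of the excess, \<open>h\<close> satisfies the inequality by
    construction; only its convergence to 0 remains to be shown.\<close>
  define h where "h x = max 0 (\<bar>g x\<bar> / x - 1 / ln x * I x)" for x
  have I: "I x = integral {1..x} (\<lambda>t. \<bar>rem t\<bar> / t\<^sup>2)" for x
    unfolding I_def by (rule integral_cong) (simp add: g)
  obtain D where D: "sublog D" "\<And>x. x \<ge> 1 \<Longrightarrow> \<bar>rem x\<bar> * ln x \<le> dilate_sum (\<lambda>t. \<bar>rem t\<bar>) x + D x"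
    using rem_ln_le_dilate_sum by blast
  obtain L where "\<And>x. x \<ge> 1 \<Longrightarrow> \<bar>majorant x\<bar> \<le> L * x" using majorant_linear_bound by blast
  from sublog_add[OF sublog_linear_bound[OF this] D(1)]
  have DM: "sublog (\<lambda>x. majorant x + D x)" .
  have main: "\<bar>g x\<bar> * ln x \<le> x * I x + (majorant x + D x)" if "x \<ge> 1" for x
    using D(2)[OF that] dilate_sum_le_integral[OF that] g[OF that] by (simp add: I)
  have "(h \<longlongrightarrow> 0) at_top"
  proof (rule tendstoI)
    fix \<epsilon> :: real assume e: "\<epsilon> > 0"
    obtain K where K: "K \<ge> 0" "\<And>x. x \<ge> 1 \<Longrightarrow> \<bar>majorant x + D x\<bar> \<le> \<epsilon>/2 * (x * ln x) + K * x"
      using sublogE[OF DM, of "\<epsilon>/2"] e by auto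
    show "\<forall>\<^sub>F x in at_top. dist (h x) 0 < \<epsilon>"
      \<comment> \<open>Beyond this point \<open>K * x\<close> is less than
        \<open>\<epsilon>/2 * (x * ln x)\<close>, so the whole error is below
        \<open>\<epsilon> * (x * ln x)\<close>.\<close>
      using eventually_gt_at_top[of "exp (2 * K / \<epsilon>)"] eventually_gt_at_top[of 1]
    proof eventually_elim
      case (elim x)
      have l: "ln x > 0" using elim by simp
      have "ln x > 2 * K / \<epsilon>" using elim by (metis exp_gt_zero ln_exp ln_less_cancel_iff order_less_trans)
      then have "K < \<epsilon>/2 * ln x" using e by (simp add: field_simps)
      then have "K * x < \<epsilon>/2 * ln x * x" using elim by (intro mult_strict_right_mono) auto
      moreover have "\<epsilon>/2 * (x * ln x) + \<epsilon>/2 * ln x * x = \<epsilon> * (x * ln x)" by simp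
      moreover have "majorant x + D x \<le> \<epsilon>/2 * (x * ln x) + K * x" using K(2)[of x] elim by simp
      ultimately have "\<bar>g x\<bar> * ln x < x * I x + \<epsilon> * (x * ln x)"
        using main[of x] elim by linarith
      then have "\<bar>g x\<bar> / x < 1 / ln x * I x + \<epsilon>" using l elim by (simp add: field_simps)
      then show ?case using e by (simp add: h_def)
    qed
  qed
  moreover have "\<bar>g x\<bar> / x \<le> 1 / ln x * I x + h x" for x by (simp add: h_def)
  ultimately show ?thesis unfolding I_def by blast
qed

end
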